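(* Let $n\ge 3$ and let $z_1,\ldots,z_n$ be points of the open unit disc in $\mathbb{C}$ which are the positively oriented (listed counterclockwise along the boundary) vertices of a hyperbolic $n$-gon in the Poincaré disc model, consecutive vertices being distinct. Put $z_{n+1}=z_1$ and $$a_k=\frac{1-\bar z_k z_{k+1}}{z_{k+1}-z_k},\qquad k=1,\ldots,n.$$ Let $A$ be the hyperbolic area and $P$ the hyperbolic perimeter of the $n$-gon. Then $$A+iP=\frac{2}{i}\sum_{k=1}^n\log\left(\frac{|a_k|^2+\overline{a_k z_k}}{|a_k|^2+|a_k|}\right),$$ where $\log$ is the principal branch of the logarithm.
   Context: The Poincaré disc model is the unit disc with the conformal metric $\frac{2}{1-|z|^2}|dz|$: the hyperbolic length of a curve $\gamma$ is $\int_\gamma\frac{2}{1-|z|^2}|dz|$, and the hyperbolic area of a region $\mathcal{R}$ is $\iint_{\mathcal{R}}\left(\frac{2}{1-x^2-y^2}\right)^2dx\,dy$. The geodesic joining two distinct points of the open disc is an arc, inside the disc, of a circle meeting the unit circle at right angles, or a Euclidean segment of a diameter. A hyperbolic $n$-gon with vertices $z_1,\ldots,z_n$ is the region bounded by the closed curve consisting of the geodesics from $z_k$ to $z_{k+1}$ (with $z_{n+1}=z_1$), where this closed curve is assumed to be a Jordan curve. Its perimeter is the hyperbolic length of this boundary curve. *)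

theory Defs
  imports "HOL-Complex_Analysis.Complex_Analysis"
begin

definition hyp_length :: "(real \<Rightarrow> complex) \<Rightarrow> real" where
  "hyp_length \<gamma> =
     integral {0..1} (\<lambda>t. 2 / (1 - (cmod (\<gamma> t))\<^sup>2) * norm (vector_derivative \<gamma> (at t)))"

definition hyp_area :: "complex set \<Rightarrow> real" where
  "hyp_area R = (LINT w:R|lebesgue. (2 / (1 - (Re w)\<^sup>2 - (Im w)\<^sup>2))\<^sup>2)"

text \<open>Two circles meet at right angles at a point iff their radii at this point are orthogonal.\<close>

definition orthogonal_to_unit_circle :: "complex \<Rightarrow> real \<Rightarrow> bool" where
  "orthogonal_to_unit_circle c r \<longleftrightarrow>
     r > 0 \<and> sphere c r \<inter> sphere 0 1 \<noteq> {} \<and>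
     (\<forall>p \<in> sphere c r \<inter> sphere 0 1. orthogonal (p - 0) (p - c))"

text \<open>The image of a geodesic is determined by its end points. In the circle case the image has
  to stay inside the disc, which rules out the complementary arc (and wrapping around).\<close>

definition hyp_geodesic :: "(real \<Rightarrow> complex) \<Rightarrow> complex \<Rightarrow> complex \<Rightarrow> bool" where
  "hyp_geodesic g z w \<longleftrightarrow>
     pathstart g = z \<and> pathfinish g = w \<and> path_image g \<subseteq> ball 0 1 \<and>
     ((\<exists>c r s t. orthogonal_to_unit_circle c r \<and> g = part_circlepath c r s t) \<or>
      (\<exists>u. norm u = 1 \<and> g = linepath z w \<and> path_image g \<subseteq> closed_segment (-u) u))"

text \<open>The path \<open>\<gamma>\<close> is the boundary of the hyperbolic polygon with vertices
  \<open>z 1, \<dots>, z n\<close>, where \<open>z (n + 1) = z 1\<close>. The polygon itself is the region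
  \<open>inside (path_image \<gamma>)\<close>.\<close>

definition hyp_polygon_boundary :: "nat \<Rightarrow> (nat \<Rightarrow> complex) \<Rightarrow> (real \<Rightarrow> complex) \<Rightarrow> bool" where
  "hyp_polygon_boundary n z \<gamma> \<longleftrightarrow>
     (\<exists>g. (\<forall>k\<in>{1..n}. hyp_geodesic (g k) (z k) (z (k + 1))) \<and>
          \<gamma> = foldl (+++) (g 1) (map g [2..<n + 1])) \<and>
     simple_path \<gamma> \<and> pathfinish \<gamma> = pathstart \<gamma>"

definition positively_oriented :: "(real \<Rightarrow> complex) \<Rightarrow> bool" where
  "positively_oriented \<gamma> \<longleftrightarrow> (\<forall>w \<in> inside (path_image \<gamma>). winding_number \<gamma> w = 1)"

end

(* The area is the integral of the density 4/(1-|w|^2)^2 times the winding number, and the winding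
   number is an integral of 1/(u-w) along the boundary. Exchanging the two integrals replaces Green's
   theorem: the Cauchy transform of a radial density follows from the mean value property, and the
   area becomes (2/i) times the integral of cnj u/(1-|u|^2) du along the boundary. On an orthogonal
   circle parametrised by the angle the imaginary part of this form is -1/2 times the angle
   differential, so an edge from z to w contributes 2 Arg(1 - z cnj w). The vertex term is a positive
   multiple of 1 - z cnj w, and its modulus is exp(-d(z,w)/2) up to a factor that cancels around
   the polygon, where d denotes hyperbolic distance. *)

theory Submission
  imports Defs
begin

text \<open>Two singularities have to be controlled. The density blows up on the unit circle, but
  the boundary is compact in the open disc, so the density can be cut off at a radius
  \<open>R < 1\<close> beyond it. The kernel \<open>1 / (u - w)\<close> blows up at
  \<open>w = u\<close>, but its integral against a bounded density has a bound independent of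
  \<open>u\<close>, which is all the exchange of integrals asks for. The cut-off does no harm: the
  Cauchy transform of a radial density at \<open>z\<close> is \<open>m / z\<close>, where
  \<open>m\<close> is the mass of the disc of radius \<open>|z|\<close>. Here
  \<open>m = 4 * pi * |z|^2 / (1 - |z|^2)\<close>, and the factor \<open>1 / (2 * pi * \<i>)\<close>
  of the winding number leaves the constant \<open>2 / \<i>\<close>. Only the imaginary part of each
  edge integral is evaluated. The real parts have no such simple form, but they cancel in the sum
  because the area is real. Branches of the logarithm cause no trouble: \<open>1 - z * cnj w\<close>
  has positive real part for points of the disc, so its argument stays within \<open>pi / 2\<close>
  of zero. The same fact limits an edge to less than half of its circle, so its angle is recovered
  from \<open>Arg\<close> without a multiple of \<open>2 * pi\<close>.\<close>

section \<open>Radial integrals and rotations of the plane\<close>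

text \<open>Polar coordinates with the angle integrated out. For \<open>0 \<le> x \<le> 1\<close>
  the annulus \<open>x < |w|^2 < 1\<close> has area \<open>pi * (1 - x)\<close>, and agreement on
  all \<open>{x<..}\<close> determines the measure. The variable \<open>u = |w|^2\<close> absorbs
  the Jacobian.\<close>

lemma distr_norm_square_lborel_unit_disc:
  "distr (density lborel (indicator (ball 0 1 :: complex set))) borel (\<lambda>w. (cmod w)\<^sup>2) =
   density lborel (\<lambda>u. ennreal pi * indicator {0..1} u)" (is "?M = ?N")
proof (rule measure_eqI_lessThan)
  have M: "emeasure ?M {x<..} = emeasure lborel (ball (0::complex) 1 \<inter> {w. x < (cmod w)\<^sup>2})" for x
  proof -
    have eq: "(\<lambda>w::complex. (cmod w)\<^sup>2) -` {x<..} = {w. x < (cmod w)\<^sup>2}" by auto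
    have [simp]: "{w::complex. x < (cmod w)\<^sup>2} \<in> sets borel" by measurable
    have "emeasure ?M {x<..} = emeasure (density lborel (indicator (ball 0 1))) {w::complex. x < (cmod w)\<^sup>2}"
      by (subst emeasure_distr) (simp_all add: eq)
    also have "\<dots> = (\<integral>\<^sup>+w. indicator (ball (0::complex) 1) w * indicator {w. x < (cmod w)\<^sup>2} w \<partial>lborel)"
      by (rule emeasure_density) (simp_all add: borel_measurable_indicator)
    also have "\<dots> = emeasure lborel (ball (0::complex) 1 \<inter> {w. x < (cmod w)\<^sup>2})"
      by (simp add: indicator_inter_arith[symmetric])
    finally show ?thesis .
  qed
  have N: "emeasure ?N {x<..} = ennreal pi * emeasure lborel ({0..1} \<inter> {x<..})" for x
    by (subst emeasure_density) (simp_all add: mult.assoc nn_integral_cmult indicator_inter_arith[symmetric])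
  show "emeasure ?M {x<..} < \<infinity>" for x
    unfolding M by (rule le_less_trans[OF emeasure_mono[of _ "ball 0 1"]]) (auto simp: emeasure_ball)
  have disc: "emeasure lborel (ball (0::complex) 1) = ennreal pi"
    by (simp add: emeasure_ball unit_ball_vol_2)
  show "emeasure ?M {x<..} = emeasure ?N {x<..}" for x
  proof -
    consider "x < 0" | "0 \<le> x" "x \<le> 1" | "1 < x" by linarith
    then show ?thesis
    proof cases
      case 1
      then have "ball (0::complex) 1 \<inter> {w. x < (cmod w)\<^sup>2} = ball 0 1" "{0..1} \<inter> {x<..} = {0..1}"
        using zero_le_power2 by (auto intro: less_le_trans)
      then show ?thesis by (simp only: M N disc) simp
    next
      case 2
      have "cmod w \<le> sqrt x \<longleftrightarrow> (cmod w)\<^sup>2 \<le> x" for w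
        by (metis abs_norm_cancel real_sqrt_abs real_sqrt_le_iff)
      then have eq: "ball (0::complex) 1 \<inter> {w. x < (cmod w)\<^sup>2} = ball 0 1 - cball 0 (sqrt x)"
        by auto
      have eq': "{0..1} \<inter> {x<..} = {x<..1}" using 2 by auto
      have "emeasure lborel (ball (0::complex) 1 - cball 0 (sqrt x)) = ennreal (pi - pi * x)"
      \<comment> \<open>For \<open>x = 1\<close> the closed disc is not contained in the open one,
        so the measure of the difference cannot be obtained by subtraction.\<close>
      proof (cases "x = 1")
        case True
        then have "ball (0::complex) 1 - cball 0 (sqrt x) = {}" by auto
        then show ?thesis by (simp only: True) simp
      next
        case False
        with 2 have "cball (0::complex) (sqrt x) \<subseteq> ball 0 1"
          by (simp add: cball_subset_ball_iff)
        then have "emeasure lborel (ball (0::complex) 1 - cball 0 (sqrt x)) =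
            emeasure lborel (ball (0::complex) 1) - emeasure lborel (cball 0 (sqrt x) :: complex set)"
          using 2 by (intro emeasure_Diff) (simp_all add: emeasure_cball)
        also have "\<dots> = ennreal (pi - pi * x)"
          using 2 by (simp add: disc emeasure_cball unit_ball_vol_2 ennreal_minus)
        finally show ?thesis .
      qed
      then show ?thesis using 2
        by (simp add: M N eq eq' ennreal_mult'[symmetric] right_diff_distrib)
    next
      case 3
      have "(cmod w)\<^sup>2 < 1" if "cmod w < 1" for w :: complex
        using that by (simp add: abs_square_less_1)
      with 3 have "ball (0::complex) 1 \<inter> {w. x < (cmod w)\<^sup>2} = {}" "{0..1} \<inter> {x<..} = {}"
        by (fastforce dest: less_trans)+
      then show ?thesis by (simp only: M N) simp
    qed
  qed
qed auto

lemma nn_integral_radial_unit_disc: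
  assumes [measurable]: "f \<in> borel_measurable borel"
  shows "(\<integral>\<^sup>+w. indicator (ball 0 1) w * f ((cmod w)\<^sup>2) \<partial>lborel) =
    (\<integral>\<^sup>+u. ennreal pi * indicator {0..1} u * f u \<partial>lborel)"
proof -
  have "(\<integral>\<^sup>+w. indicator (ball 0 1) w * f ((cmod w)\<^sup>2) \<partial>lborel) =
      (\<integral>\<^sup>+u. f u \<partial>distr (density lborel (indicator (ball 0 1 :: complex set))) borel (\<lambda>w. (cmod w)\<^sup>2))"
  proof -
    have [measurable]: "ball (0::complex) 1 \<in> sets borel" by simp
    show ?thesis
      by (subst nn_integral_distr) (simp_all add: nn_integral_density)
  qed
  also have "\<dots> = (\<integral>\<^sup>+u. ennreal pi * indicator {0..1} u * f u \<partial>lborel)"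
    unfolding distr_norm_square_lborel_unit_disc by (simp add: nn_integral_density)
  finally show ?thesis .
qed

text \<open>The singularity \<open>1 / |w|\<close> is integrable in the plane: in the variable
  \<open>u = |w|^2\<close> it becomes \<open>pi / sqrt u\<close> on \<open>{0..1}\<close>.\<close>

lemma nn_integral_inverse_norm_unit_disc:
  "(\<integral>\<^sup>+w. indicator (ball 0 1) w * ennreal (inverse (cmod w)) \<partial>lborel) = ennreal (2 * pi)"
proof -
  have "(\<integral>\<^sup>+w. indicator (ball 0 1) w * ennreal (inverse (cmod w)) \<partial>lborel) =
     (\<integral>\<^sup>+w. indicator (ball 0 1) w * ennreal (inverse (sqrt ((cmod w)\<^sup>2))) \<partial>lborel)"
    by simp
  also have "\<dots> = (\<integral>\<^sup>+u. ennreal pi * indicator {0..1} u * ennreal (inverse (sqrt u)) \<partial>lborel)"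
    by (rule nn_integral_radial_unit_disc) simp
  also have "\<dots> = (\<integral>\<^sup>+u. ennreal (indicator {0..1} u *\<^sub>R (pi * inverse (sqrt u))) \<partial>lborel)"
    by (intro nn_integral_cong) (auto simp: indicator_def ennreal_mult')
  also have "\<dots> = ennreal (2 * pi)"
  proof (rule nn_integral_has_integral_lborel)
    have "((\<lambda>u. u powr (-1/2)) has_integral (1 powr (-1/2 + 1) / (-1/2 + 1))) {0..1::real}"
      by (rule has_integral_powr_from_0) auto
    then have "((\<lambda>u. pi * u powr (-1/2)) has_integral (pi * 2)) {0..1::real}"
      by (intro has_integral_mult_right) simp
    then have "((\<lambda>u. pi * inverse (sqrt u)) has_integral (2 * pi)) {0..1::real}"
      by (rule has_integral_eq_rhs[OF has_integral_spike[of "{0}", rotated 2]])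
        (auto simp: powr_minus powr_half_sqrt)
    then show "((\<lambda>u. indicator {0..1} u *\<^sub>R (pi * inverse (sqrt u))) has_integral (2 * pi)) UNIV"
      by (subst (asm) has_integral_restrict_UNIV[symmetric])
        (rule has_integral_eq_rhs[OF has_integral_cong[THEN iffD1]], auto simp: indicator_def)
  qed (auto simp: indicator_def)
  finally show ?thesis .
qed

section \<open>Invariance of plane Lebesgue measure\<close>

lemma nn_integral_lborel_translate:
  fixes c :: "'a::euclidean_space"
  assumes [measurable]: "f \<in> borel_measurable borel"
  shows "(\<integral>\<^sup>+x. f (c + x) \<partial>lborel) = (\<integral>\<^sup>+x. f x \<partial>lborel)"
proof -
  have "(\<integral>\<^sup>+x. f x \<partial>lborel) = (\<integral>\<^sup>+x. f x \<partial>distr lborel borel ((+) c))"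
    by (simp add: lborel_distr_plus)
  then show ?thesis by (simp add: nn_integral_distr)
qed

lemma nn_integral_lborel_reflect:
  fixes c :: "'a::euclidean_space"
  assumes [measurable]: "f \<in> borel_measurable borel"
  shows "(\<integral>\<^sup>+x. f (c - x) \<partial>lborel) = (\<integral>\<^sup>+x. f x \<partial>lborel)"
proof -
  have "(\<integral>\<^sup>+x. f x \<partial>lborel) = (\<integral>\<^sup>+x. f x \<partial>distr lborel borel (\<lambda>x. c - x))"
    by (subst lborel_affine[of "-1" c]) (simp_all add: density_1)
  then show ?thesis by (simp add: nn_integral_distr)
qed

text \<open>A translation invariant measure is determined up to a factor, by evaluating
  \<open>\<integral>\<integral> 1\<^sub>A(cx) 1\<^sub>B(y + cx)\<close> in both orders; the factor is 1
  because the ball \<open>B\<close> is rotation invariant.\<close>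

lemma distr_lborel_rotate:
  fixes c :: complex
  assumes c: "cmod c = 1"
  shows "distr lborel borel ((*) c) = lborel"
proof (rule measure_eqI)
  fix A assume "A \<in> sets (distr lborel borel ((*) c))"
  then have [measurable]: "A \<in> sets borel" by simp
  have c0: "c \<noteq> 0" using c by auto
  define B :: "complex set" where "B = ball 0 1"
  have [measurable]: "B \<in> sets borel" by (simp add: B_def)
  have B: "(indicator B (c * x) :: ennreal) = indicator B x" for x
    by (simp add: B_def indicator_def norm_mult c)
  have Bfin: "emeasure lborel B = ennreal pi"
    by (simp add: B_def emeasure_ball unit_ball_vol_2)
  then have Bne: "emeasure lborel B \<noteq> 0" "emeasure lborel B \<noteq> top"
    by (simp_all add: ennreal_eq_0_iff not_le)
  have "emeasure (distr lborel borel ((*) c)) A * emeasure lborel B =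
      (\<integral>\<^sup>+x. indicator A (c * x) \<partial>lborel) * emeasure lborel B"
    by (simp add: nn_integral_indicator[symmetric] nn_integral_distr del: nn_integral_indicator)
  also have "\<dots> = (\<integral>\<^sup>+x. indicator A (c * x) * (\<integral>\<^sup>+y. indicator B (c * x + y) \<partial>lborel) \<partial>lborel)"
    by (simp add: nn_integral_multc nn_integral_lborel_translate)
  also have "\<dots> = (\<integral>\<^sup>+x. \<integral>\<^sup>+y. indicator A (c * x) * indicator B (c * x + y) \<partial>lborel \<partial>lborel)"
    by (simp add: nn_integral_cmult)
  also have "\<dots> = (\<integral>\<^sup>+y. \<integral>\<^sup>+x. indicator A (c * x) * indicator B (c * x + y) \<partial>lborel \<partial>lborel)"
    by (rule lborel_pair.Fubini') measurable
  \<comment> \<open>For fixed \<open>y\<close>, translating \<open>x\<close> by \<open>y / c\<close>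
    shifts \<open>c * x\<close> by \<open>y\<close>; thus translation invariance suffices, although
    the integrand contains the rotation.\<close>
  also have "\<dots> = (\<integral>\<^sup>+y. \<integral>\<^sup>+x. indicator A (c * x - y) * indicator B (c * x) \<partial>lborel \<partial>lborel)"
  proof (rule nn_integral_cong)
    fix y
    have "(\<integral>\<^sup>+x. indicator A (c * x - y) * indicator B (c * x) \<partial>lborel) =
       (\<integral>\<^sup>+x. indicator A (c * (y / c + x) - y) * indicator B (c * (y / c + x)) \<partial>lborel :: ennreal)"
      by (rule nn_integral_lborel_translate[symmetric]) measurable
    then show "(\<integral>\<^sup>+x. indicator A (c * x) * indicator B (c * x + y) \<partial>lborel) =
       (\<integral>\<^sup>+x. indicator A (c * x - y) * indicator B (c * x) \<partial>lborel :: ennreal)"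
      using c0 by (simp add: distrib_left add.commute)
  qed
  also have "\<dots> = (\<integral>\<^sup>+x. \<integral>\<^sup>+y. indicator A (c * x - y) * indicator B (c * x) \<partial>lborel \<partial>lborel)"
    by (rule lborel_pair.Fubini'[symmetric]) measurable
  \<comment> \<open>The inner integral over \<open>y\<close> is the measure of \<open>A\<close>
    whatever the value of \<open>c * x\<close>, and the ball does not see \<open>c\<close>.\<close>
  also have "\<dots> = (\<integral>\<^sup>+x. emeasure lborel A * indicator B x \<partial>lborel)"
    by (simp add: nn_integral_multc nn_integral_lborel_reflect B)
  also have "\<dots> = emeasure lborel A * emeasure lborel B"
    by (simp add: nn_integral_cmult)
  finally show "emeasure (distr lborel borel ((*) c)) A = emeasure lborel A"
    using mult_divide_eq_ennreal[of "emeasure lborel B"] by (metis Bne)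
qed simp

section \<open>The Cauchy transform of a radial density\<close>

text \<open>Split the kernel at distance 1 from \<open>z\<close>: farther away it is at most 1 and
  contributes at most the area \<open>pi\<close> of the disc, nearer it contributes at most
  \<open>2 * pi\<close>. The resulting bound does not depend on \<open>z\<close>.\<close>

lemma
  fixes h :: "complex \<Rightarrow> real"
  assumes [measurable]: "h \<in> borel_measurable borel"
    and h: "\<And>w. \<bar>h w\<bar> \<le> M * indicator (ball 0 1) w"
  shows integrable_cauchy_transform: "integrable lborel (\<lambda>w. of_real (h w) / (z - w))"
    and integral_norm_cauchy_transform_le: "(\<integral>w. norm (of_real (h w) / (z - w)) \<partial>lborel) \<le> M * (3 * pi)"
proof -
  have M: "0 \<le> M" using h[of 0] by (auto intro: order_trans[OF abs_ge_zero])
  have [measurable]: "ball (0::complex) 1 \<in> sets borel" by simp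
  have le: "norm (of_real (h w) / (z - w)) \<le>
      M * (indicator (ball 0 1) w + indicator (ball 0 1) (z - w) * inverse (cmod (z - w)))" for w
  proof -
    have 1: "inverse (cmod (z - w)) \<le> 1 + indicator (ball 0 1) (z - w) * inverse (cmod (z - w))"
      by (cases "cmod (z - w) < 1") (auto simp: indicator_def inverse_le_1_iff)
    have "norm (of_real (h w) / (z - w)) = \<bar>h w\<bar> * inverse (cmod (z - w))"
      by (simp add: norm_divide divide_inverse norm_mult norm_inverse)
    also have "\<dots> \<le> (M * indicator (ball 0 1) w) * (1 + indicator (ball 0 1) (z - w) * inverse (cmod (z - w)))"
      using M by (intro mult_mono h 1) (auto simp: indicator_def)
    also have "\<dots> \<le> M * (indicator (ball 0 1) w + indicator (ball 0 1) (z - w) * inverse (cmod (z - w)))"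
      using M by (auto simp: indicator_def intro!: mult_left_mono)
    finally show ?thesis .
  qed
  have "(\<integral>\<^sup>+w. ennreal (norm (of_real (h w) / (z - w))) \<partial>lborel) \<le>
      (\<integral>\<^sup>+w. ennreal (M * (indicator (ball 0 1) w + indicator (ball 0 1) (z - w) * inverse (cmod (z - w)))) \<partial>lborel)"
    by (intro nn_integral_mono ennreal_leI le)
  also have "\<dots> = (\<integral>\<^sup>+w. ennreal M * (indicator (ball 0 1) w +
      indicator (ball 0 1) (z - w) * ennreal (inverse (cmod (z - w)))) \<partial>lborel)"
    using M by (intro nn_integral_cong) (auto simp: indicator_def ennreal_mult' ennreal_plus)
  also have "\<dots> = ennreal M * ((\<integral>\<^sup>+w. indicator (ball (0::complex) 1) w \<partial>lborel) +
      (\<integral>\<^sup>+w. indicator (ball 0 1) (z - w) * ennreal (inverse (cmod (z - w))) \<partial>lborel))"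
    by (subst nn_integral_cmult, measurable, subst nn_integral_add, measurable)
  also have "(\<integral>\<^sup>+w. indicator (ball 0 1) (z - w) * ennreal (inverse (cmod (z - w))) \<partial>lborel) = ennreal (2 * pi)"
    by (subst nn_integral_lborel_reflect[of "\<lambda>w. indicator (ball 0 1) w * ennreal (inverse (cmod w))"])
      (simp_all add: nn_integral_inverse_norm_unit_disc)
  also have "(\<integral>\<^sup>+w. indicator (ball (0::complex) 1) w \<partial>lborel) = ennreal pi"
    by (simp add: emeasure_ball unit_ball_vol_2)
  also have "ennreal pi + ennreal (2 * pi) = ennreal (3 * pi)"
    by (subst ennreal_plus[symmetric]) auto
  also have "ennreal M * ennreal (3 * pi) = ennreal (M * (3 * pi))"
    using M by (simp only: ennreal_mult')
  finally have nn: "(\<integral>\<^sup>+w. ennreal (norm (of_real (h w) / (z - w))) \<partial>lborel) \<le> ennreal (M * (3 * pi))" .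
  show int: "integrable lborel (\<lambda>w. of_real (h w) / (z - w))"
    using le_less_trans[OF nn ennreal_less_top] by (intro integrableI_bounded) auto
  show "(\<integral>w. norm (of_real (h w) / (z - w)) \<partial>lborel) \<le> M * (3 * pi)"
    using nn M by (subst (asm) nn_integral_eq_integral) (auto intro!: integrable_norm int)
qed

text \<open>The uniform bound \<open>M * (3 * pi)\<close> on the inner integral gives absolute
  integrability on the product, even where the curve \<open>q\<close> runs through the support of
  \<open>h\<close>. It serves twice: with \<open>p\<close> a phase, to average over rotations, and
  with \<open>p\<close> the derivative of an edge \<open>q\<close>.\<close>

lemma
  fixes h :: "complex \<Rightarrow> real" and p q :: "real \<Rightarrow> complex"
  assumes [measurable]: "h \<in> borel_measurable borel" "p \<in> borel_measurable borel" "q \<in> borel_measurable borel"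
    and h: "\<And>w. \<bar>h w\<bar> \<le> M * indicator (ball 0 1) w"
    and p: "\<And>t. t \<in> {0..1} \<Longrightarrow> norm (p t) \<le> K"
  shows integrable_integral_cauchy_kernel:
      "integrable lborel (\<lambda>w. of_real (h w) * (LINT t:{0..1}|lborel. p t / (q t - w)))"
    and Fubini_cauchy_kernel:
      "(\<integral>w. of_real (h w) * (LINT t:{0..1}|lborel. p t / (q t - w)) \<partial>lborel) =
       (LINT t:{0..1}|lborel. p t * (\<integral>w. of_real (h w) / (q t - w) \<partial>lborel))"
proof -
  define F where "F t w = indicator {0..1} t *\<^sub>R (p t * (of_real (h w) / (q t - w)))" for t :: real and w
  have [measurable]: "case_prod F \<in> borel_measurable (lborel \<Otimes>\<^sub>M lborel)"
    unfolding F_def by measurable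
  have M: "0 \<le> M" using h[of 0] by (auto intro: order_trans[OF abs_ge_zero])
  have K: "0 \<le> K" using p[of 0] by (auto intro: order_trans[OF norm_ge_zero])
  note cauchy = integrable_cauchy_transform[OF assms(1) h] integral_norm_cauchy_transform_le[OF assms(1) h]
  have F: "integrable (lborel \<Otimes>\<^sub>M lborel) (case_prod F)"
  proof (rule lborel_pair.Fubini_integrable)
    show "integrable lborel (\<lambda>t. \<integral>w. norm (case_prod F (t, w)) \<partial>lborel)"
    proof (rule Bochner_Integration.integrable_bound)
      show "integrable lborel (\<lambda>t::real. indicator {0..1} t *\<^sub>R (K * (M * (3 * pi))))"
        by (intro integrable_scaleR_left integrable_real_indicator) simp_all
      show "AE t in lborel. norm (\<integral>w. norm (case_prod F (t, w)) \<partial>lborel) \<le>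
          norm (indicator {0..1} t *\<^sub>R (K * (M * (3 * pi))))"
      proof (intro AE_I2)
        fix t :: real
        have "(\<integral>w. norm (F t w) \<partial>lborel) =
            indicator {0..1} t * (norm (p t) * (\<integral>w. norm (of_real (h w) / (q t - w)) \<partial>lborel))"
          by (simp only: F_def norm_scaleR norm_mult abs_indicator integral_mult_right_zero)
        also have "\<dots> \<le> indicator {0..1} t * (K * (M * (3 * pi)))"
          using p[of t] K by (auto simp: indicator_def intro!: mult_mono cauchy integral_nonneg)
        finally show "norm (\<integral>w. norm (case_prod F (t, w)) \<partial>lborel) \<le>
          norm (indicator {0..1} t *\<^sub>R (K * (M * (3 * pi))))"
          using K M by (simp add: integral_nonneg abs_mult)
      qed
    qed measurable
    show "AE t in lborel. integrable lborel (\<lambda>w. case_prod F (t, w))"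
      unfolding F_def prod.case
      by (intro AE_I2 integrable_scaleR_right integrable_mult_right cauchy)
  qed measurable
  have 1: "(\<integral>t. F t w \<partial>lborel) = of_real (h w) * (LINT t:{0..1}|lborel. p t / (q t - w))" for w
    by (simp add: F_def set_lebesgue_integral_def flip: integral_mult_right_zero)
       (auto intro!: Bochner_Integration.integral_cong simp: scaleR_conv_of_real)
  have 2: "(\<integral>w. F t w \<partial>lborel) = indicator {0..1} t *\<^sub>R (p t * (\<integral>w. of_real (h w) / (q t - w) \<partial>lborel))" for t
    by (simp only: F_def integral_scaleR_right integral_mult_right_zero)
  show "integrable lborel (\<lambda>w. of_real (h w) * (LINT t:{0..1}|lborel. p t / (q t - w)))"
    using lborel_pair.integrable_snd[OF F] by (simp add: 1)
  show "(\<integral>w. of_real (h w) * (LINT t:{0..1}|lborel. p t / (q t - w)) \<partial>lborel) =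
       (LINT t:{0..1}|lborel. p t * (\<integral>w. of_real (h w) / (q t - w) \<partial>lborel))"
    using lborel_pair.Fubini_integral[OF F] by (simp add: 1 2 set_lebesgue_integral_def)
qed

text \<open>Cauchy's integral formula at the centre; the derivative \<open>2 * pi * \<i> * u\<close>
  of the circle cancels the kernel \<open>1 / u\<close>.\<close>

lemma has_integral_circle_mean:
  assumes "F holomorphic_on ball 0 r" "1 < r"
  shows "((\<lambda>t. F (cis (2 * pi * t))) has_integral F 0) {0..1}"
proof -
  have "((\<lambda>u. F u / (u - 0)) has_contour_integral 2 * of_real pi * \<i> * F 0) (circlepath 0 1)"
  proof (rule Cauchy_integral_circlepath_simple)
    show "F holomorphic_on cball 0 1"
      using assms by (intro holomorphic_on_subset[OF assms(1)]) auto
  qed simp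
  then have "((\<lambda>t. F (cis (2 * pi * t)) / cis (2 * pi * t) * (2 * of_real pi * \<i> * cis (2 * pi * t)))
      has_integral 2 * of_real pi * \<i> * F 0) {0..1}"
    unfolding has_contour_integral vector_derivative_circlepath
    by (simp add: circlepath cis_conv_exp mult_ac)
  then have "((\<lambda>t. 2 * of_real pi * \<i> * F (cis (2 * pi * t))) has_integral 2 * of_real pi * \<i> * F 0) {0..1}"
    by (simp add: mult_ac)
  from has_integral_mult_right[OF this, of "inverse (2 * of_real pi * \<i>)"] show ?thesis
    by (simp add: field_simps)
qed

lemma has_integral_inverse_circle:
  assumes "cmod w \<noteq> cmod z"
  shows "((\<lambda>t. 1 / (z - cis (2 * pi * t) * w)) has_integral (if cmod w < cmod z then 1 / z else 0)) {0..1}"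
proof (cases "cmod w < cmod z")
  case True
  then have "z \<noteq> 0" by auto
  \<comment> \<open>The pole \<open>z / w\<close> lies outside the closed unit disc, which leaves
    room for a slightly larger disc of holomorphy.\<close>
  obtain r where r: "1 < r" "r * cmod w < cmod z"
  proof (cases "w = 0")
    case True with \<open>z \<noteq> 0\<close> show ?thesis by (intro that[of 2]) auto
  next
    case False
    then have "1 < cmod z / cmod w" using True by simp
    then obtain r where "1 < r" "r < cmod z / cmod w" using dense by blast
    then show ?thesis using False by (intro that) (auto simp: field_simps)
  qed
  have "(\<lambda>u::complex. 1 / (z - u * w)) holomorphic_on ball 0 r"
  proof (intro holomorphic_intros)
    fix u :: complex assume "u \<in> ball 0 r"
    then have "cmod (u * w) \<le> r * cmod w" by (auto simp: norm_mult intro!: mult_right_mono)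
    then show "z - u * w \<noteq> 0" using r by auto
  qed
  from has_integral_circle_mean[OF this r(1)] True show ?thesis by simp
next
  case False
  with assms have less: "cmod z < cmod w" by simp
  then have "w \<noteq> 0" by auto
  obtain r where r: "1 < r" "r * cmod z < cmod w"
  proof (cases "z = 0")
    case True with \<open>w \<noteq> 0\<close> show ?thesis by (intro that[of 2]) auto
  next
    case False
    then have "1 < cmod w / cmod z" using less by simp
    then obtain r where "1 < r" "r < cmod w / cmod z" using dense by blast
    then show ?thesis using False by (intro that) (auto simp: field_simps)
  qed
  \<comment> \<open>Now the pole \<open>z / w\<close> of \<open>1 / (z - u * w)\<close> lies inside
    the unit circle. On the circle \<open>u\<close> inverse is \<open>cnj u\<close>, so the
    integrand is the conjugate of this function, whose pole is outside and whose value at 0 is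
    0.\<close>
  have "(\<lambda>u::complex. u / (cnj z * u - cnj w)) holomorphic_on ball 0 r"
  proof (intro holomorphic_intros)
    fix u :: complex assume "u \<in> ball 0 r"
    then have "cmod (cnj z * u) \<le> r * cmod z" by (auto simp: norm_mult mult.commute intro!: mult_right_mono)
    then show "cnj z * u - cnj w \<noteq> 0" using r by auto
  qed
  from has_integral_circle_mean[OF this r(1)]
  have "((\<lambda>t. cnj (cis (2 * pi * t) / (cnj z * cis (2 * pi * t) - cnj w))) has_integral cnj 0) {0..1}"
    by (subst has_integral_cnj[unfolded o_def]) simp
  moreover have "cnj (cis s / (cnj z * cis s - cnj w)) = 1 / (z - cis s * w)" for s
  proof -
    have "cis s * cnj (cis s) = 1" by (simp add: cis_cnj cis_mult)
    then have "cis s * (z * cnj (cis s) - w) = z - cis s * w" by (simp add: algebra_simps)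
    then have "1 / (z - cis s * w) = inverse (cis s) / (z * cnj (cis s) - w)"
      by (metis divide_inverse inverse_eq_divide inverse_mult_distrib)
    then show ?thesis by (simp add: cis_inverse cis_cnj)
  qed
  ultimately show ?thesis using False by simp
qed

text \<open>Averaging over rotations: the mean of \<open>1 / (z - w)\<close> over the circle of radius \<open>\<bar>w\<bar>\<close>
  is \<open>1 / z\<close> inside the disc of radius \<open>\<bar>z\<bar>\<close> and \<open>0\<close> outside.
  For \<open>z = 0\<close> both sides are \<open>0\<close>.\<close>

lemma cauchy_transform_radial:
  fixes h :: "complex \<Rightarrow> real"
  assumes [measurable]: "h \<in> borel_measurable borel"
    and h: "\<And>w. \<bar>h w\<bar> \<le> M * indicator (ball 0 1) w"
    and rad: "\<And>c w. cmod c = 1 \<Longrightarrow> h (c * w) = h w"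
  shows "(\<integral>w. of_real (h w) / (z - w) \<partial>lborel) = of_real (\<integral>w. h w * indicator (ball 0 (cmod z)) w \<partial>lborel) / z"
proof -
  define C where "C z = (\<integral>w. of_real (h w) / (z - w) \<partial>lborel)" for z :: complex
  \<comment> \<open>Substituting \<open>c * w\<close> for \<open>w\<close> keeps both the measure
    and \<open>h\<close>, so the rotation moves onto \<open>z\<close>.\<close>
  have rot: "cnj c * C (cnj c * z) = C z" if c: "cmod c = 1" for c
  proof -
    have cc: "c * cnj c = 1" using c by (simp add: complex_norm_square[symmetric])
    then have c0: "c \<noteq> 0" by auto
    have "C z = (\<integral>w. of_real (h w) / (z - w) \<partial>distr lborel borel ((*) c))"
      by (simp add: C_def distr_lborel_rotate[OF c])
    also have "\<dots> = (\<integral>w. of_real (h w) / (z - c * w) \<partial>lborel)"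
      by (subst integral_distr) (simp_all add: rad[OF c])
    also have "\<dots> = (\<integral>w. cnj c * (of_real (h w) / (cnj c * z - w)) \<partial>lborel)"
    proof (rule Bochner_Integration.integral_cong)
      fix w
      have "c * (cnj c * z - w) = z - c * w" using cc by (simp add: algebra_simps)
      then have "of_real (h w) / (z - c * w) = inverse c * (of_real (h w) / (cnj c * z - w))"
        by (metis divide_inverse inverse_mult_distrib mult.left_commute)
      also have "inverse c = cnj c" using cc c0 by (simp add: field_simps)
      finally show "of_real (h w) / (z - c * w) = cnj c * (of_real (h w) / (cnj c * z - w))" .
    qed simp
    finally show ?thesis by (simp only: C_def integral_mult_right_zero)
  qed
  have phase: "(\<lambda>t. cnj (cis (2 * pi * t))) \<in> borel_measurable borel"
    by (intro borel_measurable_continuous_onI continuous_intros)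
  then have phase_mult: "(\<lambda>t. cnj (cis (2 * pi * t)) * z) \<in> borel_measurable borel"
    by simp
  have norm_phase: "cmod (cnj (cis (2 * pi * t))) \<le> 1" for t by simp
  note kernel = assms(1) phase phase_mult h norm_phase
  have [measurable]: "ball (0::complex) (cmod z) \<in> sets borel" by simp
  \<comment> \<open>The constant is written as an average over all rotations. Exchanging the
    integrals then puts the average on the kernel, where the mean value over a circle is
    known.\<close>
  have "C z = (LINT t:{0..1::real}|lborel. C z)"
    unfolding set_lebesgue_integral_def by (subst integral_scaleR_left) simp_all
  also have "\<dots> = (LINT t:{0..1}|lborel. cnj (cis (2 * pi * t)) * C (cnj (cis (2 * pi * t)) * z))"
    by (subst rot) simp_all
  also have "\<dots> = (\<integral>w. of_real (h w) *
      (LINT t:{0..1}|lborel. cnj (cis (2 * pi * t)) / (cnj (cis (2 * pi * t)) * z - w)) \<partial>lborel)"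
    unfolding C_def by (rule Fubini_cauchy_kernel[symmetric, OF kernel])
  also have "\<dots> = (\<integral>w. of_real (h w * indicator (ball 0 (cmod z)) w) / z \<partial>lborel)"
  proof (rule integral_cong_AE)
    \<comment> \<open>On the circle \<open>|w| = |z|\<close> the averaged kernel is singular; this
      circle is a null set.\<close>
    have "sphere 0 (cmod z) \<in> null_sets (lborel :: complex measure)"
      using negligible_sphere[of "0::complex" "cmod z"] by (simp add: negligible_iff_null_sets null_sets_completion_iff)
    then have "AE w in lborel. w \<notin> sphere (0::complex) (cmod z)"
      by (rule AE_not_in)
    then show "AE w in lborel. of_real (h w) * (LINT t:{0..1}|lborel. cnj (cis (2 * pi * t)) / (cnj (cis (2 * pi * t)) * z - w)) =
        of_real (h w * indicator (ball 0 (cmod z)) w) / z"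
    proof eventually_elim
      case (elim w)
      then have ne: "cmod w \<noteq> cmod z" by simp
      have eq: "cnj (cis s) / (cnj (cis s) * z - w) = 1 / (z - cis s * w)" for s
      proof -
        have cc: "cis s * cnj (cis s) = 1" by (simp add: cis_cnj cis_mult)
        then have "cis s * (cnj (cis s) * z - w) = z - cis s * w" by (simp add: algebra_simps)
        then have "1 / (z - cis s * w) = inverse (cis s) / (cnj (cis s) * z - w)"
          by (metis divide_inverse inverse_eq_divide inverse_mult_distrib)
        then show ?thesis by (simp add: cis_inverse cis_cnj)
      qed
      have "z - cis s * w \<noteq> 0" for s
      proof
        assume "z - cis s * w = 0"
        then have "cmod z = cmod (cis s * w)" by simp
        then show False using ne by (simp add: norm_mult)
      qed
      then have "set_integrable lborel {0..1} (\<lambda>t. 1 / (z - cis (2 * pi * t) * w))"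
        by (intro borel_integrable_compact[unfolded set_integrable_def[symmetric]] compact_Icc continuous_intros) auto
      from set_borel_integral_eq_integral(2)[OF this]
      have "(LINT t:{0..1}|lborel. 1 / (z - cis (2 * pi * t) * w)) = (if cmod w < cmod z then 1 / z else 0)"
        using has_integral_inverse_circle[OF ne] by (simp add: integral_unique)
      then show ?case by (simp add: eq indicator_def)
    qed
    show "(\<lambda>w. of_real (h w) * (LINT t:{0..1}|lborel. cnj (cis (2 * pi * t)) / (cnj (cis (2 * pi * t)) * z - w)))
        \<in> borel_measurable lborel"
      using integrable_integral_cauchy_kernel[OF kernel] by (rule borel_measurable_integrable)
  qed measurable
  also have "\<dots> = of_real (\<integral>w. h w * indicator (ball 0 (cmod z)) w \<partial>lborel) / z"
    by (simp only: integral_divide_zero integral_complex_of_real)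
  finally show ?thesis by (simp add: C_def)
qed

section \<open>Area as a contour integral\<close>

text \<open>In the variable \<open>u = |w|^2\<close> the integrand is
  \<open>4 * pi / (1 - u)^2\<close>, with antiderivative \<open>4 * pi / (1 - u)\<close>.\<close>

lemma integral_poincare_density_disc:
  assumes "0 \<le> s" "s < 1"
  shows "(\<integral>w. (2 / (1 - (cmod w)\<^sup>2))\<^sup>2 * indicator (ball 0 s) w \<partial>lborel) = 4 * pi * s\<^sup>2 / (1 - s\<^sup>2)"
proof (rule integral_eq_nn_integral[THEN trans])
  have s2: "s\<^sup>2 < 1" using assms by (simp add: abs_square_less_1)
  \<comment> \<open>The open disc gives \<open>u < s^2\<close>, the fundamental theorem the closed
    interval; they differ in one point.\<close>
  have null: "AE u in lborel. u \<noteq> s\<^sup>2" by (rule AE_lborel_singleton)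
  have ae: "AE u in lborel. ennreal pi * indicator {0..1} u * ennreal ((2 / (1 - u))\<^sup>2 * indicator {..<s\<^sup>2} u) =
      ennreal (pi * (2 / (1 - u))\<^sup>2) * indicator {0..s\<^sup>2} u"
    using null by eventually_elim (use s2 in \<open>auto simp: indicator_def ennreal_mult'[symmetric]\<close>)
  have lt: "(cmod w)\<^sup>2 < s\<^sup>2 \<longleftrightarrow> cmod w < s" for w
    using assms by (meson abs_le_square_iff norm_ge_zero not_le power_mono power_strict_mono zero_less_numeral)
  have "(\<integral>\<^sup>+w. ennreal ((2 / (1 - (cmod w)\<^sup>2))\<^sup>2 * indicator (ball 0 s) w) \<partial>lborel) =
      (\<integral>\<^sup>+w. indicator (ball 0 1) w * ennreal ((2 / (1 - (cmod w)\<^sup>2))\<^sup>2 * indicator {..<s\<^sup>2} ((cmod w)\<^sup>2)) \<partial>lborel)"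
    using assms by (intro nn_integral_cong) (auto simp: indicator_def lt)
  also have "\<dots> = (\<integral>\<^sup>+u. ennreal pi * indicator {0..1} u * ennreal ((2 / (1 - u))\<^sup>2 * indicator {..<s\<^sup>2} u) \<partial>lborel)"
    by (rule nn_integral_radial_unit_disc[where f = "\<lambda>u. ennreal ((2 / (1 - u))\<^sup>2 * indicator {..<s\<^sup>2} u)"]) measurable
  also have "\<dots> = (\<integral>\<^sup>+u. ennreal (pi * (2 / (1 - u))\<^sup>2) * indicator {0..s\<^sup>2} u \<partial>lborel)"
    by (rule nn_integral_cong_AE[OF ae])
  also have "\<dots> = ennreal (4 * pi / (1 - s\<^sup>2) - 4 * pi / (1 - 0))"
  proof (rule nn_integral_FTC_Icc)
    fix u assume "u \<in> {0..s\<^sup>2}"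
    then have "u < 1" using s2 by auto
    then show "((\<lambda>u. 4 * pi / (1 - u)) has_real_derivative pi * (2 / (1 - u))\<^sup>2) (at u)"
      by (auto intro!: derivative_eq_intros simp: field_simps power2_eq_square)
  qed auto
  also have "4 * pi / (1 - s\<^sup>2) - 4 * pi / (1 - 0) = 4 * pi * s\<^sup>2 / (1 - s\<^sup>2)"
    using s2 by (simp add: field_simps)
  finally show "enn2real (\<integral>\<^sup>+w. ennreal ((2 / (1 - (cmod w)\<^sup>2))\<^sup>2 * indicator (ball 0 s) w) \<partial>lborel) =
      4 * pi * s\<^sup>2 / (1 - s\<^sup>2)"
    using s2 by simp
qed (auto simp: indicator_def)

text \<open>Cutting off at \<open>R < 1\<close> makes the density bounded, as the Cauchy transform
  lemmas require. For \<open>|z| < R\<close> the transform only sees the disc of radius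
  \<open>|z|\<close>, hence not the cut-off.\<close>

lemma
  assumes R: "0 < R" "R < 1"
  defines "h \<equiv> \<lambda>w. (2 / (1 - (cmod w)\<^sup>2))\<^sup>2 * indicator (ball 0 R) w"
  shows poincare_density_measurable: "h \<in> borel_measurable borel"
    and poincare_density_le: "\<bar>h w\<bar> \<le> (2 / (1 - R\<^sup>2))\<^sup>2 * indicator (ball 0 1) w"
    and cauchy_transform_poincare_density: "cmod z < R \<Longrightarrow>
      (\<integral>w. of_real (h w) / (z - w) \<partial>lborel) = 4 * pi * cnj z / (1 - (cmod z)\<^sup>2)"
proof -
  have R2: "R\<^sup>2 < 1" using R by (simp add: abs_square_less_1)
  have [measurable]: "ball (0::complex) R \<in> sets borel" by simp
  show meas: "h \<in> borel_measurable borel" unfolding h_def by measurable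
  show le: "\<bar>h w\<bar> \<le> (2 / (1 - R\<^sup>2))\<^sup>2 * indicator (ball 0 1) w" for w
  proof (cases "cmod w < R")
    case True
    then have "(cmod w)\<^sup>2 \<le> R\<^sup>2" by (intro power_mono) auto
    then have "2 / (1 - (cmod w)\<^sup>2) \<le> 2 / (1 - R\<^sup>2)" "0 \<le> 2 / (1 - (cmod w)\<^sup>2)" using R2
      by (auto intro!: divide_left_mono mult_pos_pos)
    then have "(2 / (1 - (cmod w)\<^sup>2))\<^sup>2 \<le> (2 / (1 - R\<^sup>2))\<^sup>2" by (intro power_mono)
    then show ?thesis using True R by (simp add: h_def indicator_def)
  qed (simp add: h_def indicator_def)
  show "(\<integral>w. of_real (h w) / (z - w) \<partial>lborel) = 4 * pi * cnj z / (1 - (cmod z)\<^sup>2)" if z: "cmod z < R"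
  proof -
    have "(\<integral>w. of_real (h w) / (z - w) \<partial>lborel) = of_real (\<integral>w. h w * indicator (ball 0 (cmod z)) w \<partial>lborel) / z"
      by (rule cauchy_transform_radial[OF meas le]) (simp add: h_def norm_mult indicator_def)
    also have "(\<lambda>w. h w * indicator (ball 0 (cmod z)) w) = (\<lambda>w. (2 / (1 - (cmod w)\<^sup>2))\<^sup>2 * indicator (ball 0 (cmod z)) w)"
      using z by (auto simp: h_def indicator_def)
    also have "(\<integral>w. (2 / (1 - (cmod w)\<^sup>2))\<^sup>2 * indicator (ball 0 (cmod z)) w \<partial>lborel) = 4 * pi * (cmod z)\<^sup>2 / (1 - (cmod z)\<^sup>2)"
      using z R by (intro integral_poincare_density_disc) auto
    \<comment> \<open>The factor \<open>|z|^2 = z * cnj z\<close> removes the division by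
      \<open>z\<close>; at \<open>z = 0\<close> both sides are 0 because division by zero yields
      0.\<close>
    also have "complex_of_real (4 * pi * (cmod z)\<^sup>2 / (1 - (cmod z)\<^sup>2)) / z = 4 * pi * cnj z / (1 - (cmod z)\<^sup>2)"
      by (cases "z = 0") (simp_all add: complex_norm_square[unfolded of_real_power] divide_simps)
    finally show ?thesis .
  qed
qed

text \<open>Bridges the gauge integral behind \<open>contour_integral\<close> and the Lebesgue
  integral needed for the exchange of integrals.\<close>

lemma contour_integral_eq_LINT:
  assumes g: "g C1_differentiable_on UNIV" and f: "continuous_on (path_image g) f"
  shows "contour_integral g f = (LINT t:{0..1}|lborel. f (g t) * vector_derivative g (at t))"
proof -
  have "continuous_on {0..1} g"
    using g by (auto simp: C1_differentiable_on_eq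
        intro!: continuous_at_imp_continuous_on differentiable_imp_continuous_within)
  moreover have "continuous_on {0..1} (\<lambda>t. vector_derivative g (at t))"
    using g continuous_on_subset by (auto simp: C1_differentiable_on_eq)
  ultimately have "set_integrable lborel {0..1} (\<lambda>t. f (g t) * vector_derivative g (at t))"
    using f by (intro borel_integrable_compact[unfolded set_integrable_def[symmetric]] compact_Icc
        continuous_intros continuous_on_compose2[OF f]) (auto simp: path_image_def)
  from set_borel_integral_eq_integral(2)[OF this] show ?thesis
    by (simp add: contour_integral_integral)
qed

text \<open>Off the curve, \<open>N w\<close> is the contour integral of \<open>1 / (u - w)\<close>,
  so this is the share of one edge in \<open>2 * pi * \<i>\<close> times the area. Differentiability
  on all of \<open>UNIV\<close> provides the Borel measurability of \<open>g\<close> and of its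
  derivative.\<close>

lemma
  assumes R: "0 < R" "R < 1" and g: "g C1_differentiable_on UNIV" "path_image g \<subseteq> ball 0 R"
  defines "h \<equiv> \<lambda>w. (2 / (1 - (cmod w)\<^sup>2))\<^sup>2 * indicator (ball 0 R) w"
    and "N \<equiv> \<lambda>w. LINT t:{0..1}|lborel. vector_derivative g (at t) / (g t - w)"
  shows integrable_density_times_index: "integrable lborel (\<lambda>w. of_real (h w) * N w)"
    and integral_density_times_index: "(\<integral>w. of_real (h w) * N w \<partial>lborel) =
      4 * pi * contour_integral g (\<lambda>u. cnj u / (1 - (cmod u)\<^sup>2))"
proof -
  have g': "continuous_on UNIV (\<lambda>t. vector_derivative g (at t))" "continuous_on UNIV g"
    using g(1) by (simp_all add: C1_differentiable_on_eq continuous_at_imp_continuous_on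
        differentiable_imp_continuous_within)
  have meas: "(\<lambda>t. vector_derivative g (at t)) \<in> borel_measurable borel" "g \<in> borel_measurable borel"
    using g' by (auto intro: borel_measurable_continuous_onI)
  have "compact ((\<lambda>t. vector_derivative g (at t)) ` {0..1})"
    by (intro compact_continuous_image continuous_on_subset[OF g'(1)]) auto
  from compact_imp_bounded[OF this]
  obtain K where "\<forall>t\<in>{0..1}. norm (vector_derivative g (at t)) \<le> K"
    by (auto simp: bounded_iff)
  then have K: "\<And>t. t \<in> {0..1} \<Longrightarrow> norm (vector_derivative g (at t)) \<le> K" by blast
  note h = poincare_density_measurable[OF R] poincare_density_le[OF R]
  note * = h(1) meas h(2) K
  show "integrable lborel (\<lambda>w. of_real (h w) * N w)"
    unfolding h_def N_def by (rule integrable_integral_cauchy_kernel[OF *])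
  have lt: "cmod (g t) < R" if "t \<in> {0..1}" for t
    using g(2) that by (auto simp: path_image_def image_subset_iff)
  have ne: "1 - (complex_of_real (cmod u))\<^sup>2 \<noteq> 0" if "u \<in> path_image g" for u
  proof -
    have "cmod u < 1" using that g(2) R by auto
    then have "(cmod u)\<^sup>2 < 1" by (simp add: abs_square_less_1)
    then show ?thesis by (metis eq_iff_diff_eq_0 less_irrefl of_real_eq_1_iff of_real_power)
  qed
  have transform: "(\<integral>w. of_real (h w) / (g t - w) \<partial>lborel) = 4 * pi * cnj (g t) / (1 - (cmod (g t))\<^sup>2)"
    if "t \<in> {0..1}" for t
    unfolding h_def by (rule cauchy_transform_poincare_density[OF R lt[OF that]])
  have "(\<integral>w. of_real (h w) * N w \<partial>lborel) = (LINT t:{0..1}|lborel. vector_derivative g (at t) *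
      (\<integral>w. of_real (h w) / (g t - w) \<partial>lborel))"
    unfolding h_def N_def by (rule Fubini_cauchy_kernel[OF *])
  also have "\<dots> = (LINT t:{0..1}|lborel. 4 * pi * (cnj (g t) / (1 - (cmod (g t))\<^sup>2) * vector_derivative g (at t)))"
    by (intro set_lebesgue_integral_cong) (auto simp: transform)
  also have "\<dots> = 4 * pi * contour_integral g (\<lambda>u. cnj u / (1 - (cmod u)\<^sup>2))"
    using ne by (subst contour_integral_eq_LINT[OF g(1)])
      (auto intro!: continuous_intros simp del: times_divide_eq_right)
  finally show "(\<integral>w. of_real (h w) * N w \<partial>lborel) = 4 * pi * contour_integral g (\<lambda>u. cnj u / (1 - (cmod u)\<^sup>2))" .
qed

text \<open>The winding number is 1 inside and 0 outside, hence acts as the indicator of the region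
  almost everywhere. It is supplied as a sum over edges because each edge is smooth while the whole
  boundary has corners.\<close>

theorem hyp_area_inside_eq_contour_integrals:
  fixes g :: "'k \<Rightarrow> real \<Rightarrow> complex"
  assumes \<gamma>: "path \<gamma>" "pathfinish \<gamma> = pathstart \<gamma>" "path_image \<gamma> \<subseteq> ball 0 1"
      "negligible (path_image \<gamma>)" "positively_oriented \<gamma>"
    and g: "\<And>k. k \<in> K \<Longrightarrow> g k C1_differentiable_on UNIV" "\<And>k. k \<in> K \<Longrightarrow> path_image (g k) \<subseteq> path_image \<gamma>"
    and wind: "\<And>w. w \<notin> path_image \<gamma> \<Longrightarrow>
      winding_number \<gamma> w = 1 / (2 * pi * \<i>) * (\<Sum>k\<in>K. contour_integral (g k) (\<lambda>u. 1 / (u - w)))"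
  shows "complex_of_real (hyp_area (inside (path_image \<gamma>))) =
    2 / \<i> * (\<Sum>k\<in>K. contour_integral (g k) (\<lambda>u. cnj u / (1 - (cmod u)\<^sup>2)))"
proof -
  have "compact (path_image \<gamma>)" using \<gamma> by (simp add: compact_path_image)
  \<comment> \<open>By compactness \<open>|u|\<close> attains a maximum on the boundary, and
    \<open>R\<close> is taken between it and 1.\<close>
  then obtain R where R: "0 < R" "R < 1" "path_image \<gamma> \<subseteq> ball 0 R"
  proof -
    have "compact (cmod ` path_image \<gamma>)" "cmod ` path_image \<gamma> \<noteq> {}"
      using \<open>compact (path_image \<gamma>)\<close> by (auto intro!: compact_continuous_image continuous_intros)
    then obtain m where m: "m \<in> path_image \<gamma>" "\<And>u. u \<in> path_image \<gamma> \<Longrightarrow> cmod u \<le> cmod m"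
      using compact_attains_sup[of "cmod ` path_image \<gamma>"] by auto
    then have "cmod m < 1" using \<gamma>(3) by auto
    then obtain R where "cmod m < R" "R < 1" using dense by blast
    moreover from this have "0 < R" using norm_ge_zero[of m] by linarith
    ultimately show ?thesis by (intro that) (auto dest!: m(2))
  qed
  define h where "h w = (2 / (1 - (cmod w)\<^sup>2))\<^sup>2 * indicator (ball 0 R) w" for w :: complex
  define N where "N k w = (LINT t:{0..1}|lborel. vector_derivative (g k) (at t) / (g k t - w))" for k w
  note gR = g(1) subset_trans[OF g(2) R(3)]
  have int: "integrable lborel (\<lambda>w. of_real (h w) * N k w)"
    and eq: "(\<integral>w. of_real (h w) * N k w \<partial>lborel) = 4 * pi * contour_integral (g k) (\<lambda>u. cnj u / (1 - (cmod u)\<^sup>2))"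
    if "k \<in> K" for k
    using integrable_density_times_index[OF R(1,2) gR(1)[OF that] gR(2)[OF that]]
      integral_density_times_index[OF R(1,2) gR(1)[OF that] gR(2)[OF that]]
    by (simp_all only: h_def N_def)
  have [measurable]: "inside (path_image \<gamma>) \<in> sets borel"
    using \<open>compact (path_image \<gamma>)\<close> by (intro borel_open open_inside compact_imp_closed)
  \<comment> \<open>The complement of a convex set that contains the curve lies outside the curve;
    so the cut-off leaves the density unchanged on the region.\<close>
  have sub: "inside (path_image \<gamma>) \<subseteq> ball 0 R"
    using outside_subset_convex[OF convex_ball R(3)] inside_Int_outside by blast
  have "path_image \<gamma> \<in> null_sets lborel"
    using \<gamma>(4) \<open>compact (path_image \<gamma>)\<close>
    by (simp add: negligible_iff_null_sets null_sets_completion_iff borel_compact)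
  then have ae: "AE w in lborel. w \<notin> path_image \<gamma>" by (rule AE_not_in)
  have "complex_of_real (hyp_area (inside (path_image \<gamma>))) =
      of_real (\<integral>w. indicator (inside (path_image \<gamma>)) w * (2 / (1 - (Re w)\<^sup>2 - (Im w)\<^sup>2))\<^sup>2 \<partial>lborel)"
    by (simp add: hyp_area_def set_lebesgue_integral_def integral_completion)
  also have "\<dots> = (\<integral>w. of_real (indicator (inside (path_image \<gamma>)) w * (2 / (1 - (Re w)\<^sup>2 - (Im w)\<^sup>2))\<^sup>2) \<partial>lborel)"
    by (rule integral_complex_of_real[symmetric])
  also have "\<dots> = (\<integral>w. 1 / (2 * pi * \<i>) * (\<Sum>k\<in>K. of_real (h w) * N k w) \<partial>lborel)"
  proof (rule integral_cong_AE)
    show "(\<lambda>w. 1 / (2 * pi * \<i>) * (\<Sum>k\<in>K. of_real (h w) * N k w)) \<in> borel_measurable lborel"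
      using borel_measurable_integrable[OF int]
      by (rule borel_measurable_times[OF borel_measurable_const borel_measurable_sum])
    show "AE w in lborel. of_real (indicator (inside (path_image \<gamma>)) w * (2 / (1 - (Re w)\<^sup>2 - (Im w)\<^sup>2))\<^sup>2) =
        1 / (2 * pi * \<i>) * (\<Sum>k\<in>K. of_real (h w) * N k w)"
      using ae
    proof eventually_elim
      case (elim w)
      have "N k w = contour_integral (g k) (\<lambda>u. 1 / (u - w))" if "k \<in> K" for k
        unfolding N_def using elim g(2)[OF that]
        by (subst contour_integral_eq_LINT[OF g(1)[OF that]]) (auto intro!: continuous_intros)
      then have "1 / (2 * pi * \<i>) * (\<Sum>k\<in>K. of_real (h w) * N k w) = of_real (h w) * winding_number \<gamma> w"
        by (simp add: wind[OF elim] sum_distrib_left[symmetric])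
      also have "\<dots> = of_real (indicator (inside (path_image \<gamma>)) w * (2 / (1 - (Re w)\<^sup>2 - (Im w)\<^sup>2))\<^sup>2)"
      proof (cases "w \<in> inside (path_image \<gamma>)")
        case True
        then have "winding_number \<gamma> w = 1" using \<gamma>(5) by (auto simp: positively_oriented_def)
        then show ?thesis using True sub
          by (auto simp: h_def indicator_def cmod_power2 diff_diff_eq)
      next
        case False
        then have "w \<in> outside (path_image \<gamma>)" using elim inside_Un_outside by blast
        then have "winding_number \<gamma> w = 0" using \<gamma> by (intro winding_number_zero_in_outside) auto
        then show ?thesis using False by simp
      qed
      finally show ?case by (rule sym)
    qed
  qed measurable
  also have "\<dots> = 1 / (2 * pi * \<i>) * (\<Sum>k\<in>K. \<integral>w. of_real (h w) * N k w \<partial>lborel)"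
    using int by (simp only: integral_mult_right_zero Bochner_Integration.integral_sum)
  also have "\<dots> = 1 / (2 * pi * \<i>) * (4 * pi * (\<Sum>k\<in>K. contour_integral (g k) (\<lambda>u. cnj u / (1 - (cmod u)\<^sup>2))))"
    by (simp add: eq sum_distrib_left cong: sum.cong)
  also have "\<dots> = 2 / \<i> * (\<Sum>k\<in>K. contour_integral (g k) (\<lambda>u. cnj u / (1 - (cmod u)\<^sup>2)))"
    by simp
  finally show ?thesis .
qed

section \<open>Geodesics\<close>

text \<open>Pythagoras in the triangle with vertices 0, \<open>c\<close> and a common point of the
  circles, where the angle is right.\<close>

lemma orthogonal_to_unit_circle_norm_center:
  assumes "orthogonal_to_unit_circle c r"
  shows "(cmod c)\<^sup>2 = 1 + r\<^sup>2"
proof -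
  have "sphere c r \<inter> sphere 0 1 \<noteq> {}"
    using assms by (simp add: orthogonal_to_unit_circle_def)
  then obtain p where p: "p \<in> sphere c r" "p \<in> sphere 0 1" by blast
  with assms have orth: "orthogonal p (p - c)" by (simp add: orthogonal_to_unit_circle_def)
  have "p \<bullet> p = 1" using p(2) by (simp add: dot_square_norm)
  then have "p \<bullet> c = 1" using orth by (simp add: orthogonal_def inner_diff_right)
  moreover have "(p - c) \<bullet> (p - c) = r\<^sup>2"
    using p(1) by (simp add: dot_square_norm dist_norm norm_minus_commute)
  moreover have "(p - c) \<bullet> (p - c) = p \<bullet> p - 2 * (p \<bullet> c) + c \<bullet> c"
    by (simp add: inner_diff_left inner_diff_right inner_commute)
  ultimately have "c \<bullet> c = 1 + r\<^sup>2" using \<open>p \<bullet> p = 1\<close> by linarith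
  then show ?thesis by (simp add: dot_square_norm)
qed

text \<open>The parameter \<open>\<phi>\<close> is half the angle between \<open>E 0\<close> and \<open>E \<phi>\<close>; this makes
  \<open>\<bar>sin \<phi>\<bar> / D \<phi>\<close> the pseudo-hyperbolic distance of these points. The centre of the circle
  is \<open>p + \<i>q\<close> in coordinates rotated by \<open>s\<close>.\<close>

locale orthogonal_arc =
  fixes c :: complex and r s t :: real
  assumes orth: "orthogonal_to_unit_circle c r"
    and in_disc: "path_image (part_circlepath c r s t) \<subseteq> ball 0 1"
    and s_neq_t: "s \<noteq> t"
begin

definition p where "p = Re (cnj c * cis s)"
definition q where "q = - Im (cnj c * cis s)"
definition E where "E \<phi> = c + r * cis (s + 2 * \<phi>)"
text \<open>The real factor left in \<open>1 - E 0 * cnj (E \<phi>)\<close> once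
  \<open>2 * r\<close> and the phase \<open>cis (- \<phi>)\<close> are split off; the sign makes it
  positive along the arc.\<close>

definition D where "D \<phi> = - ((r + p) * cos \<phi> + q * sin \<phi>)"

lemma r_pos: "r > 0"
  using orth by (simp add: orthogonal_to_unit_circle_def)

lemma pq: "p\<^sup>2 + q\<^sup>2 = 1 + r\<^sup>2"
proof -
  have "p\<^sup>2 + q\<^sup>2 = (cmod (cnj c * cis s))\<^sup>2"
    by (simp only: cmod_power2 p_def q_def power2_minus)
  then show ?thesis
    using orthogonal_to_unit_circle_norm_center[OF orth] by (simp add: norm_mult)
qed

lemma center: "cnj c * cis s = Complex p (- q)" "c * cnj (cis s) = Complex p q"
  by (simp_all add: p_def q_def complex_eq_iff)

lemma part_circlepath_eq: "part_circlepath c r s t x = E (x * (t - s) / 2)"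
proof -
  have "s + 2 * (x * (t - s) / 2) = linepath s t x" by (simp add: linepath_def field_simps)
  then show ?thesis by (simp add: part_circlepath_def E_def cis_conv_exp)
qed

lemma one_minus_norm_E: "1 - (cmod (E \<phi>))\<^sup>2 = - 2 * r * (r + p * cos (2 * \<phi>) + q * sin (2 * \<phi>))"
proof -
  have "complex_of_real ((cmod (E \<phi>))\<^sup>2) = c * cnj c + r * (cnj c * cis s) * cis (2 * \<phi>)
      + r * (c * cnj (cis s)) * cnj (cis (2 * \<phi>))
      + r\<^sup>2 * ((cis s * cnj (cis s)) * (cis (2 * \<phi>) * cnj (cis (2 * \<phi>))))"
    unfolding complex_norm_square E_def cis_mult[symmetric]
    by (simp add: algebra_simps power2_eq_square)
  also have "\<dots> = 1 + r\<^sup>2 + r * Complex p (- q) * cis (2 * \<phi>) + r * Complex p q * cnj (cis (2 * \<phi>)) + r\<^sup>2"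
    using orthogonal_to_unit_circle_norm_center[OF orth]
    by (simp add: center complex_norm_square[symmetric] flip: of_real_power)
  finally have "(cmod (E \<phi>))\<^sup>2 = Re (1 + r\<^sup>2 + r * Complex p (- q) * cis (2 * \<phi>) + r * Complex p q * cnj (cis (2 * \<phi>)) + r\<^sup>2)"
    by (metis Re_complex_of_real)
  then show ?thesis by (simp add: algebra_simps power2_eq_square)
qed

text \<open>Since \<open>|c|^2 = 1 + r^2\<close>, the 1 cancels and \<open>r\<close> factors out of
  the rest. Pulling out \<open>cis (- \<phi>)\<close> pairs the remaining terms into conjugates, so
  a real factor is left: the argument is minus half the swept angle, up to the sign of
  \<open>D \<phi>\<close>.\<close>

lemma one_minus_E_cnj_E: "1 - E 0 * cnj (E \<phi>) = of_real (2 * r * D \<phi>) * cis (- \<phi>)"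
proof -
  have "E 0 * cnj (E \<phi>) = c * cnj c + r * (c * cnj (cis s)) * cnj (cis (2 * \<phi>))
      + r * (cnj c * cis s) + r\<^sup>2 * ((cis s * cnj (cis s)) * cnj (cis (2 * \<phi>)))"
    unfolding E_def cis_mult[symmetric] by (simp add: algebra_simps power2_eq_square)
  also have "\<dots> = 1 + r\<^sup>2 + r * Complex p q * cnj (cis (2 * \<phi>)) + r * Complex p (- q) + r\<^sup>2 * cnj (cis (2 * \<phi>))"
    using orthogonal_to_unit_circle_norm_center[OF orth]
    by (simp add: center complex_norm_square[symmetric] flip: of_real_power)
  finally have eq: "E 0 * cnj (E \<phi>) =
      1 + r\<^sup>2 + r * Complex p q * cnj (cis (2 * \<phi>)) + r * Complex p (- q) + r\<^sup>2 * cnj (cis (2 * \<phi>))" .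
  show ?thesis
  proof (rule complex_eqI)
    have "Re (1 - E 0 * cnj (E \<phi>)) =
        1 - (1 + r\<^sup>2 + r * (p * cos (2 * \<phi>) + q * sin (2 * \<phi>)) + r * p + r\<^sup>2 * cos (2 * \<phi>))"
      unfolding eq by (simp add: distrib_left)
    also have "\<dots> = 2 * r * D \<phi> * cos \<phi>"
      unfolding D_def cos_double sin_double using sin_cos_squared_add[of \<phi>] by algebra
    finally show "Re (1 - E 0 * cnj (E \<phi>)) = Re (of_real (2 * r * D \<phi>) * cis (- \<phi>))"
      by simp
    have "Im (1 - E 0 * cnj (E \<phi>)) =
        - (r * (q * cos (2 * \<phi>) - p * sin (2 * \<phi>)) - r * q - r\<^sup>2 * sin (2 * \<phi>))"
      unfolding eq by (simp add: right_diff_distrib)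
    also have "\<dots> = - (2 * r * D \<phi> * sin \<phi>)"
      unfolding D_def cos_double sin_double using sin_cos_squared_add[of \<phi>] by algebra
    finally show "Im (1 - E 0 * cnj (E \<phi>)) = Im (of_real (2 * r * D \<phi>) * cis (- \<phi>))"
      by simp
  qed
qed

text \<open>The identity \<open>|1 - z * cnj w|^2 - |w - z|^2 = (1 - |z|^2) * (1 - |w|^2)\<close> on
  the arc, divided by \<open>4 * r^2\<close>.\<close>

lemma D_sin_squared: "(D \<phi>)\<^sup>2 - (sin \<phi>)\<^sup>2 = (1 - (cmod (E 0))\<^sup>2) * (1 - (cmod (E \<phi>))\<^sup>2) / (4 * r\<^sup>2)"
proof -
  have "(D \<phi>)\<^sup>2 - (sin \<phi>)\<^sup>2 = (r + p) * (r + p * cos (2 * \<phi>) + q * sin (2 * \<phi>))"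
    unfolding D_def cos_double sin_double
    using pq sin_cos_squared_add[of \<phi>] by algebra
  then show ?thesis using r_pos
    unfolding one_minus_norm_E by (simp add: power2_eq_square)
qed

lemma norm_E_diff: "cmod (E \<phi> - E 0) = 2 * r * \<bar>sin \<phi>\<bar>"
proof -
  have "E \<phi> - E 0 = r * cis s * (cis (2 * \<phi>) - 1)"
    by (simp add: E_def cis_mult[symmetric] algebra_simps)
  also have "cis (2 * \<phi>) - 1 = 2 * \<i> * sin \<phi> * cis \<phi>"
    by (simp add: complex_eq_iff cos_double_sin sin_double power2_eq_square)
  finally show ?thesis using r_pos by (simp add: norm_mult)
qed

lemma norm_E_less:
  assumes "x \<in> {0..1}"
  shows "cmod (E (x * (t - s) / 2)) < 1"
proof -
  have "part_circlepath c r s t x \<in> ball 0 1"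
    using in_disc assms unfolding path_image_def by blast
  then show ?thesis unfolding part_circlepath_eq by simp
qed

text \<open>The midpoint \<open>E (\<phi> / 2)\<close> of the arc lies in the disc, and \<open>D \<phi>\<close> dominates
  \<open>(1 - \<bar>E (\<phi> / 2)\<bar>\<^sup>2) / (2 r)\<close>.\<close>

lemma D_pos:
  assumes "x \<in> {0..1}"
  shows "0 < D (x * (t - s) / 2)"
proof -
  define \<phi> where "\<phi> = x * (t - s) / 2"
  have "x / 2 * (t - s) / 2 = \<phi> / 2" by (simp add: \<phi>_def)
  then have "cmod (E (\<phi> / 2)) < 1" using norm_E_less[of "x / 2"] assms by (simp only:) simp
  then have "0 < 1 - (cmod (E (\<phi> / 2)))\<^sup>2" by (simp add: abs_square_less_1)
  also have "\<dots> = 2 * r * (- (r + p * cos \<phi> + q * sin \<phi>))" by (simp add: one_minus_norm_E algebra_simps)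
  finally have "0 < - (r + p * cos \<phi> + q * sin \<phi>)" using r_pos by (simp only: zero_less_mult_iff) simp
  also have "\<dots> \<le> D \<phi>" using mult_left_mono[OF cos_le_one[of \<phi>], of r] r_pos
    by (simp add: D_def algebra_simps)
  finally show ?thesis by (simp only: \<phi>_def)
qed

text \<open>The pseudo-hyperbolic distance of two points of the disc is below 1; this keeps the
  logarithms in the length formula defined.\<close>

lemma sin_less_D:
  assumes "x \<in> {0..1}"
  shows "\<bar>sin (x * (t - s) / 2)\<bar> < D (x * (t - s) / 2)"
proof -
  have "cmod (E 0) < 1" using norm_E_less[of 0] by simp
  then have "0 < (D (x * (t - s) / 2))\<^sup>2 - (sin (x * (t - s) / 2))\<^sup>2"
    unfolding D_sin_squared using norm_E_less[OF assms] r_pos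
    by (intro divide_pos_pos mult_pos_pos) (auto simp: abs_square_less_1)
  then show ?thesis using D_pos[OF assms]
    by (metis abs_le_square_iff abs_of_pos diff_gt_0_iff_gt not_le)
qed

text \<open>An arc of at least a half turn would contain the point antipodal to \<open>E 0\<close>
  on its circle, where \<open>1 - E 0 * cnj (E \<phi>)\<close> is purely imaginary. For points of
  the disc its real part is positive.\<close>

lemma half_angle_less: "\<bar>(t - s) / 2\<bar> < pi / 2"
proof (rule ccontr)
  assume "\<not> ?thesis"
  then have ge: "pi \<le> \<bar>t - s\<bar>" by simp
  \<comment> \<open>The parameter at which the arc has turned by exactly \<open>pi\<close>, so that
    the half angle is \<open>pi / 2\<close> up to sign.\<close>
  define x where "x = pi / \<bar>t - s\<bar>"
  have x: "x \<in> {0..1}" using ge s_neq_t by (auto simp: x_def)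
  have "\<bar>x * (t - s) / 2\<bar> = pi / 2" using s_neq_t by (simp add: x_def abs_mult)
  then have "cos (x * (t - s) / 2) = 0" by (metis cos_abs_real cos_pi_half)
  then have "Re (1 - E 0 * cnj (E (x * (t - s) / 2))) = 0"
    unfolding one_minus_E_cnj_E by simp
  moreover have "cmod (E 0) * cmod (E (x * (t - s) / 2)) \<le> cmod (E 0) * 1"
    using norm_E_less[OF x] by (intro mult_left_mono) auto
  then have "cmod (E 0 * cnj (E (x * (t - s) / 2))) < 1"
    using norm_E_less[of 0] by (simp add: norm_mult)
  then have "Re (E 0 * cnj (E (x * (t - s) / 2))) < 1"
    using complex_Re_le_cmod le_less_trans by blast
  ultimately show False by simp
qed

lemma part_circlepath_derivative:
  "(part_circlepath c r s t has_vector_derivative \<i> * r * (t - s) * cis (s + x * (t - s))) (at x)"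
  using has_vector_derivative_part_circlepath[of c r s t x UNIV]
  by (simp add: cis_conv_exp linepath_def algebra_simps)

lemma Arg_one_minus: "Arg (1 - E 0 * cnj (E ((t - s) / 2))) = - ((t - s) / 2)"
proof -
  have "Arg (cis (- ((t - s) / 2))) = - ((t - s) / 2)"
  proof (rule Arg_cis)
    have "- pi < - ((t - s) / 2)" "- ((t - s) / 2) \<le> pi"
      using half_angle_less pi_gt_zero by linarith+
    then show "- ((t - s) / 2) \<in> {- pi<..pi}" by simp
  qed
  then show ?thesis
    unfolding one_minus_E_cnj_E using D_pos[of 1] r_pos by (subst Arg_times_of_real) simp_all
qed

lemma C1: "part_circlepath c r s t C1_differentiable_on UNIV"
  unfolding C1_differentiable_on_def
  by (intro exI[of _ "\<lambda>x. \<i> * r * (t - s) * cis (s + x * (t - s))"] conjI ballI part_circlepath_derivative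
      continuous_intros)

text \<open>Put \<open>u = E \<phi>\<close>. Expanding \<open>|u - c|^2 = r^2\<close> with
  \<open>|c|^2 = 1 + r^2\<close> gives \<open>2 * (u \<bullet> c) = |u|^2 + 1\<close>, hence the
  value of \<open>u \<bullet> (u - c)\<close>.\<close>

lemma Re_cnj_E_times: "Re (cnj (E \<phi>) * (r * cis (s + 2 * \<phi>))) = - (1 - (cmod (E \<phi>))\<^sup>2) / 2"
proof -
  have "cnj (E \<phi>) * (r * cis (s + 2 * \<phi>)) = r * ((cnj c * cis s) * cis (2 * \<phi>))
      + r\<^sup>2 * ((cis s * cnj (cis s)) * (cis (2 * \<phi>) * cnj (cis (2 * \<phi>))))"
    unfolding E_def cis_mult[symmetric] by (simp add: algebra_simps power2_eq_square)
  also have "\<dots> = r * (Complex p (- q) * cis (2 * \<phi>)) + r\<^sup>2"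
    by (simp add: center complex_norm_square[symmetric])
  finally have "Re (cnj (E \<phi>) * (r * cis (s + 2 * \<phi>))) = r * (p * cos (2 * \<phi>) + q * sin (2 * \<phi>)) + r\<^sup>2"
    by simp
  then show ?thesis
    unfolding one_minus_norm_E by (simp add: power2_eq_square algebra_simps)
qed

text \<open>By \<open>Re_cnj_E_times\<close> the weight \<open>1 / (1 - |u|^2)\<close> cancels
  pointwise, and the imaginary part of the integrand is constant.\<close>

lemma Im_contour_integral:
  "Im (contour_integral (part_circlepath c r s t) (\<lambda>u. cnj u / (1 - (cmod u)\<^sup>2))) = - (t - s) / 2"
proof -
  let ?g = "part_circlepath c r s t"
  let ?f = "\<lambda>x. cnj (?g x) / (1 - (cmod (?g x))\<^sup>2) * (\<i> * r * (t - s) * cis (s + x * (t - s)))"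
  have ne: "1 - (cmod (?g x))\<^sup>2 \<noteq> 0" if "x \<in> {0..1}" for x
    using norm_E_less[OF that] abs_square_less_1[of "cmod (?g x)"] by (simp add: part_circlepath_eq)
  have "1 - (complex_of_real (cmod (?g x)))\<^sup>2 \<noteq> 0" if "x \<in> {0..1}" for x
    using ne[OF that] by (metis eq_iff_diff_eq_0 of_real_eq_1_iff of_real_power)
  moreover have "continuous_on {0..1} ?g"
    using path_part_circlepath by (simp add: path_def)
  ultimately have int: "?f integrable_on {0..1}"
    by (intro integrable_continuous_real continuous_intros) auto
  have Im: "Im (?f x) = - (t - s) / 2" if x: "x \<in> {0..1}" for x
  proof -
    have "s + 2 * (x * (t - s) / 2) = s + x * (t - s)" by simp
    then have "Re (cnj (?g x) * (r * cis (s + x * (t - s)))) = - (1 - (cmod (?g x))\<^sup>2) / 2"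
      using Re_cnj_E_times[of "x * (t - s) / 2"] unfolding part_circlepath_eq by (simp only:)
    moreover have "?f x = of_real ((t - s) / (1 - (cmod (?g x))\<^sup>2)) * (\<i> * (cnj (?g x) * (r * cis (s + x * (t - s)))))"
      by simp
    moreover have "Im (of_real k * (\<i> * v)) = k * Re v" for k v by simp
    ultimately have "Im (?f x) = (t - s) / (1 - (cmod (?g x))\<^sup>2) * (- (1 - (cmod (?g x))\<^sup>2) / 2)"
      by (simp only:)
    also have "\<dots> = - (t - s) / 2" 
    proof -
      have "k / d * (- d / 2) = - k / 2" if "d \<noteq> 0" for k d :: real using that by simp
      then show ?thesis using ne[OF x] .
    qed
    finally show ?thesis .
  qed
  have "contour_integral ?g (\<lambda>u. cnj u / (1 - (cmod u)\<^sup>2)) = integral {0..1} ?f"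
    by (simp add: contour_integral_integral vector_derivative_at[OF part_circlepath_derivative])
  then have "Im (contour_integral ?g (\<lambda>u. cnj u / (1 - (cmod u)\<^sup>2))) = integral {0..1} (\<lambda>x. Im (?f x))"
    using integral_linear[OF int bounded_linear_Im] by (simp add: o_def)
  also have "\<dots> = integral {0..1} (\<lambda>x::real. - (t - s) / 2)"
    by (rule integral_cong) (rule Im)
  finally show ?thesis by simp
qed

text \<open>With \<open>v = sin \<phi> / D \<phi>\<close>, the function
  \<open>ln ((1 + v) / (1 - v))\<close> is the signed hyperbolic distance from \<open>E 0\<close>
  along the arc; \<open>F\<close> is this antiderivative.\<close>

lemma has_integral_length:
  defines "T \<equiv> \<bar>sin ((t - s) / 2)\<bar> / D ((t - s) / 2)"
  shows "((\<lambda>x. 2 / (1 - (cmod (part_circlepath c r s t x))\<^sup>2) *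
      norm (vector_derivative (part_circlepath c r s t) (at x))) has_integral ln ((1 + T) / (1 - T))) {0..1}"
proof -
  define F where "F x = ln (D (x * (t - s) / 2) + sin (x * (t - s) / 2)) -
      ln (D (x * (t - s) / 2) - sin (x * (t - s) / 2))" for x
  have deriv: "(F has_real_derivative 2 * r * (t - s) / (1 - (cmod (part_circlepath c r s t x))\<^sup>2)) (at x within {0..1})"
    if x: "x \<in> {0..1}" for x
  proof -
    let ?\<phi> = "x * (t - s) / 2"
    have pos: "0 < D ?\<phi> + sin ?\<phi>" "0 < D ?\<phi> - sin ?\<phi>"
      using sin_less_D[OF x] by linarith+
    let ?D' = "((r + p) * sin ?\<phi> - q * cos ?\<phi>) * ((t - s) / 2)"
    let ?S' = "cos ?\<phi> * ((t - s) / 2)"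
    have D': "((\<lambda>x. D (x * (t - s) / 2)) has_real_derivative ?D') (at x within {0..1})"
    proof (rule DERIV_chain2[where f = D and g = "\<lambda>x. x * (t - s) / 2"])
      show "(D has_real_derivative (r + p) * sin ?\<phi> - q * cos ?\<phi>) (at ?\<phi>)"
        unfolding D_def[abs_def] by (auto intro!: derivative_eq_intros)
      show "((\<lambda>x. x * (t - s) / 2) has_real_derivative (t - s) / 2) (at x within {0..1})"
        by (auto intro!: derivative_eq_intros)
    qed
    have S': "((\<lambda>x. sin (x * (t - s) / 2)) has_real_derivative ?S') (at x within {0..1})"
      by (auto intro!: derivative_eq_intros)
    have "(F has_real_derivative (?D' + ?S') / (D ?\<phi> + sin ?\<phi>) - (?D' - ?S') / (D ?\<phi> - sin ?\<phi>)) (at x within {0..1})"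
      unfolding F_def[abs_def]
      using DERIV_diff[OF DERIV_chain2[OF DERIV_ln_divide[OF pos(1)] DERIV_add[OF D' S']]
          DERIV_chain2[OF DERIV_ln_divide[OF pos(2)] DERIV_diff[OF D' S']]] by simp
    also have "(?D' + ?S') / (D ?\<phi> + sin ?\<phi>) - (?D' - ?S') / (D ?\<phi> - sin ?\<phi>) =
        2 * (?S' * D ?\<phi> - ?D' * sin ?\<phi>) / ((D ?\<phi>)\<^sup>2 - (sin ?\<phi>)\<^sup>2)"
    proof -
      have "(A + B) / (X + Y) - (A - B) / (X - Y) = 2 * (B * X - A * Y) / (X\<^sup>2 - Y\<^sup>2)"
        if "0 < X + Y" "0 < X - Y" for A B X Y :: real
      proof -
        have "X\<^sup>2 - Y\<^sup>2 = (X + Y) * (X - Y)" by (simp add: power2_eq_square algebra_simps)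
        moreover have "(A + B) * (X - Y) - (A - B) * (X + Y) = 2 * (B * X - A * Y)"
          by (simp add: algebra_simps)
        ultimately show ?thesis using that by (simp add: diff_frac_eq)
      qed
      from this[OF pos] show ?thesis .
    qed
    \<comment> \<open>A Wronskian: \<open>sin\<close> and \<open>D\<close> solve the same equation
      \<open>f'' = - f\<close>, so this expression is constant. Its value contains the factor
      \<open>1 - |E 0|^2\<close>, which cancels against the one in
      \<open>D_sin_squared\<close>.\<close>
    also have "?S' * D ?\<phi> - ?D' * sin ?\<phi> = - (r + p) * ((t - s) / 2)"
      unfolding D_def using sin_cos_squared_add[of ?\<phi>] by algebra
    also have "- (r + p) * ((t - s) / 2) = (1 - (cmod (E 0))\<^sup>2) * (t - s) / (4 * r)"
      using r_pos unfolding one_minus_norm_E by (simp add: field_simps)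
    also have "2 * ((1 - (cmod (E 0))\<^sup>2) * (t - s) / (4 * r)) / ((D ?\<phi>)\<^sup>2 - (sin ?\<phi>)\<^sup>2) =
        2 * r * (t - s) / (1 - (cmod (part_circlepath c r s t x))\<^sup>2)"
    proof -
      have "1 - (cmod (E 0))\<^sup>2 \<noteq> 0" "1 - (cmod (E ?\<phi>))\<^sup>2 \<noteq> 0"
        using norm_E_less[of 0] norm_E_less[OF x] by (auto simp: abs_square_eq_1)
      then show ?thesis using r_pos
        unfolding D_sin_squared part_circlepath_eq by (simp add: divide_simps power2_eq_square)
    qed
    finally show ?thesis .
  qed
  have "((\<lambda>x. 2 * r * (t - s) / (1 - (cmod (part_circlepath c r s t x))\<^sup>2)) has_integral (F 1 - F 0)) {0..1}"
    using deriv by (intro fundamental_theorem_of_calculus) (auto simp: has_real_derivative_iff_has_vector_derivative[symmetric])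
  \<comment> \<open>\<open>F\<close> decreases when the arc runs clockwise; the factor
    \<open>sgn (t - s)\<close> turns the signed distance into length.\<close>
  then have "((\<lambda>x. sgn (t - s) * (2 * r * (t - s) / (1 - (cmod (part_circlepath c r s t x))\<^sup>2)))
      has_integral sgn (t - s) * (F 1 - F 0)) {0..1}"
    by (rule has_integral_mult_right)
  moreover have "sgn (t - s) * (2 * r * (t - s) / (1 - (cmod (part_circlepath c r s t x))\<^sup>2)) =
      2 / (1 - (cmod (part_circlepath c r s t x))\<^sup>2) * norm (vector_derivative (part_circlepath c r s t) (at x))" for x
  proof -
    have "sgn (t - s) * (t - s) = \<bar>t - s\<bar>" by (simp add: abs_sgn mult.commute)
    moreover have "cmod (vector_derivative (part_circlepath c r s t) (at x)) = r * \<bar>t - s\<bar>"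
      unfolding vector_derivative_at[OF part_circlepath_derivative] of_real_diff[symmetric]
      using r_pos by (simp add: norm_mult del: of_real_diff)
    moreover have "\<sigma> * (2 * r * k / d) = 2 / d * (r * (\<sigma> * k))" for \<sigma> k d :: real by simp
    ultimately show ?thesis by (simp only:)
  qed
  moreover have "sgn (t - s) * (F 1 - F 0) = ln ((1 + T) / (1 - T))"
  proof -
    let ?S = "sin ((t - s) / 2)" and ?D = "D ((t - s) / 2)"
    have half: "- pi < (t - s) / 2" "(t - s) / 2 < pi"
      using half_angle_less pi_gt_zero unfolding abs_less_iff by linarith+
    have less: "\<bar>?S\<bar> < ?D" and pos: "0 < ?D" using sin_less_D[of 1] D_pos[of 1] by simp_all
    then have "(1 + T) / (1 - T) = (?D + \<bar>?S\<bar>) / (?D - \<bar>?S\<bar>)"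
      unfolding T_def by (simp add: field_simps)
    then have "ln ((1 + T) / (1 - T)) = ln (?D + \<bar>?S\<bar>) - ln (?D - \<bar>?S\<bar>)"
      using less pos by (simp add: ln_div)
    moreover have "F 0 = 0" by (simp add: F_def)
    moreover have "sgn (t - s) * F 1 = ln (?D + \<bar>?S\<bar>) - ln (?D - \<bar>?S\<bar>)"
    proof (cases "s < t")
      case True
      have "0 < ?S" using True half by (intro sin_gt_zero) simp_all
      then show ?thesis using True by (simp add: F_def)
    next
      case False
      have "0 < - ((t - s) / 2)" using False s_neq_t by simp
      moreover have "- ((t - s) / 2) < pi" using half(1) by linarith
      ultimately have "0 < sin (- ((t - s) / 2))" by (rule sin_gt_zero)
      then have "?S < 0" by (simp only: sin_minus)
      then show ?thesis using False s_neq_t by (simp add: F_def)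
    qed
    ultimately show ?thesis by simp
  qed
  ultimately show ?thesis by (simp only:)
qed

lemma endpoints:
  "pathstart (part_circlepath c r s t) = E 0" "pathfinish (part_circlepath c r s t) = E ((t - s) / 2)"
  by (simp_all add: pathstart_def pathfinish_def part_circlepath_eq)

lemma cross_ratio_endpoints:
  "cmod (E ((t - s) / 2) - E 0) / cmod (1 - E 0 * cnj (E ((t - s) / 2))) = \<bar>sin ((t - s) / 2)\<bar> / D ((t - s) / 2)"
  unfolding norm_E_diff one_minus_E_cnj_E using r_pos D_pos[of 1]
  by (simp add: norm_mult)

end

section \<open>Geodesics along a diameter\<close>

text \<open>The antiderivative is \<open>2 * artanh\<close> of the signed distance from 0, written
  with logarithms; \<open>T\<close> arises from the subtraction formula for
  \<open>tanh\<close>.\<close>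

lemma has_integral_length_diameter:
  fixes x y :: real
  assumes u: "cmod u = 1" and x: "\<bar>x\<bar> < 1" and y: "\<bar>y\<bar> < 1"
  defines "g \<equiv> linepath (of_real x * u) (of_real y * u)" and "T \<equiv> \<bar>y - x\<bar> / (1 - x * y)"
  shows "((\<lambda>t. 2 / (1 - (cmod (g t))\<^sup>2) * norm (vector_derivative g (at t))) has_integral ln ((1 + T) / (1 - T))) {0..1}"
proof -
  define \<rho> where "\<rho> t = x + t * (y - x)" for t
  have g: "g t = of_real (\<rho> t) * u" for t
    by (simp add: g_def linepath_def \<rho>_def scaleR_conv_of_real algebra_simps)
  have \<rho>: "\<bar>\<rho> t\<bar> < 1" if "t \<in> {0..1}" for t
  proof -
    have "\<bar>\<rho> t\<bar> = \<bar>(1 - t) * x + t * y\<bar>" by (simp add: \<rho>_def algebra_simps)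
    also have "\<dots> \<le> (1 - t) * max \<bar>x\<bar> \<bar>y\<bar> + t * max \<bar>x\<bar> \<bar>y\<bar>"
      using that by (intro order_trans[OF abs_triangle_ineq] add_mono) (auto simp: abs_mult intro!: mult_left_mono)
    also have "\<dots> = max \<bar>x\<bar> \<bar>y\<bar>" by (simp add: algebra_simps)
    finally show ?thesis using x y by simp
  qed
  have deriv: "((\<lambda>t. ln (1 + \<rho> t) - ln (1 - \<rho> t)) has_real_derivative 2 / (1 - (\<rho> t)\<^sup>2) * (y - x)) (at t within {0..1})"
    if t: "t \<in> {0..1}" for t
  proof -
    have pos: "0 < 1 + \<rho> t" "0 < 1 - \<rho> t" using \<rho>[OF t] by linarith+
    have "(\<rho> has_real_derivative y - x) (at t within {0..1})"
      unfolding \<rho>_def[abs_def] by (auto intro!: derivative_eq_intros)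
    then have "((\<lambda>t. 1 + \<rho> t) has_real_derivative y - x) (at t within {0..1})"
        "((\<lambda>t. 1 - \<rho> t) has_real_derivative - (y - x)) (at t within {0..1})"
      by (auto intro!: derivative_eq_intros)
    from DERIV_diff[OF DERIV_chain2[OF DERIV_ln_divide[OF pos(1)] this(1)] DERIV_chain2[OF DERIV_ln_divide[OF pos(2)] this(2)]]
    have "((\<lambda>t. ln (1 + \<rho> t) - ln (1 - \<rho> t)) has_real_derivative
        1 / (1 + \<rho> t) * (y - x) - 1 / (1 - \<rho> t) * (- (y - x))) (at t within {0..1})" .
    also have "1 / (1 + \<rho> t) * (y - x) - 1 / (1 - \<rho> t) * (- (y - x)) = (1 / (1 + \<rho> t) + 1 / (1 - \<rho> t)) * (y - x)"
      by (simp only: distrib_right mult_minus_right diff_minus_eq_add)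
    also have "1 / (1 + \<rho> t) + 1 / (1 - \<rho> t) = 2 / (1 - (\<rho> t)\<^sup>2)"
      using pos by (simp add: add_frac_eq power2_eq_square algebra_simps)
    finally show ?thesis .
  qed
  have "((\<lambda>t. 2 / (1 - (\<rho> t)\<^sup>2) * (y - x)) has_integral
      (ln (1 + \<rho> 1) - ln (1 - \<rho> 1)) - (ln (1 + \<rho> 0) - ln (1 - \<rho> 0))) {0..1}"
    using deriv by (intro fundamental_theorem_of_calculus) (auto simp: has_real_derivative_iff_has_vector_derivative[symmetric])
  then have "((\<lambda>t. sgn (y - x) * (2 / (1 - (\<rho> t)\<^sup>2) * (y - x))) has_integral
      sgn (y - x) * ((ln (1 + \<rho> 1) - ln (1 - \<rho> 1)) - (ln (1 + \<rho> 0) - ln (1 - \<rho> 0)))) {0..1}"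
    by (rule has_integral_mult_right)
  moreover have "sgn (y - x) * (2 / (1 - (\<rho> t)\<^sup>2) * (y - x)) = 2 / (1 - (cmod (g t))\<^sup>2) * norm (vector_derivative g (at t))" for t
  proof -
    have "cmod (of_real y * u - of_real x * u) = \<bar>y - x\<bar>"
      using u by (simp add: left_diff_distrib[symmetric] norm_mult flip: of_real_diff)
    then have 1: "norm (vector_derivative g (at t)) = \<bar>y - x\<bar>" by (simp add: g_def)
    have 2: "cmod (g t) = \<bar>\<rho> t\<bar>" using u by (simp add: g norm_mult)
    have 3: "sgn (y - x) * (y - x) = \<bar>y - x\<bar>" by (simp add: abs_sgn mult.commute)
    show ?thesis unfolding 1 2 power2_abs by (simp only: mult.left_commute[of "sgn (y - x)"] 3)
  qed
  moreover have "sgn (y - x) * ((ln (1 + \<rho> 1) - ln (1 - \<rho> 1)) - (ln (1 + \<rho> 0) - ln (1 - \<rho> 0))) = ln ((1 + T) / (1 - T))"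
  proof -
    \<comment> \<open>The subtraction formula:
      \<open>artanh b - artanh a = artanh ((b - a) / (1 - a * b))\<close>, doubled.\<close>
    have *: "(ln (1 + b) - ln (1 - b)) - (ln (1 + a) - ln (1 - a)) =
        ln ((1 + (b - a) / (1 - a * b)) / (1 - (b - a) / (1 - a * b)))" if "\<bar>a\<bar> < 1" "\<bar>b\<bar> < 1" for a b :: real
    proof -
      have pos: "0 < 1 + a" "0 < 1 - a" "0 < 1 + b" "0 < 1 - b" using that by linarith+
      have "\<bar>a * b\<bar> < 1" using that by (simp add: abs_mult abs_mult_less[of a 1 b 1, simplified])
      then have d: "0 < 1 - a * b" by linarith
      have "1 + (b - a) / (1 - a * b) = (1 + b) * (1 - a) / (1 - a * b)"
          "1 - (b - a) / (1 - a * b) = (1 + a) * (1 - b) / (1 - a * b)"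
        using d by (simp_all add: field_simps)
      then have "(1 + (b - a) / (1 - a * b)) / (1 - (b - a) / (1 - a * b)) = ((1 + b) * (1 - a)) / ((1 + a) * (1 - b))"
        using d by simp
      then show ?thesis using pos by (simp add: ln_div ln_mult)
    qed
    consider "x < y" | "x = y" | "y < x" by linarith
    then show ?thesis
    proof cases
      case 1
      then show ?thesis using *[OF x y] by (simp add: T_def \<rho>_def)
    next
      case 3
      then show ?thesis using *[OF y x] by (simp add: T_def \<rho>_def mult.commute)
    qed (simp add: T_def \<rho>_def)
  qed
  ultimately show ?thesis by (simp only:)
qed

text \<open>Along a line through 0, \<open>cnj v\<close> times the direction is real, so the
  integrand is real.\<close>

lemma Im_contour_integral_diameter:
  fixes x y :: real
  assumes u: "cmod u = 1"
  shows "Im (contour_integral (linepath (of_real x * u) (of_real y * u)) (\<lambda>v. cnj v / (1 - (cmod v)\<^sup>2))) = 0"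
proof -
  let ?g = "linepath (of_real x * u) (of_real y * u)"
  have "cnj (?g t) / (1 - (cmod (?g t))\<^sup>2) * (of_real y * u - of_real x * u) =
      of_real ((x + t * (y - x)) / (1 - (cmod (?g t))\<^sup>2) * (y - x))" for t
  proof -
    have g: "?g t = of_real (x + t * (y - x)) * u"
      by (simp add: linepath_def scaleR_conv_of_real algebra_simps)
    have uu: "cnj u * u = 1" using u by (simp add: mult.commute complex_norm_square[symmetric])
    have "cnj (of_real (x + t * (y - x)) * u) * (of_real y * u - of_real x * u) =
        of_real ((x + t * (y - x)) * (y - x)) * (cnj u * u)"
      by (simp add: algebra_simps)
    then show ?thesis unfolding g by (simp add: uu)
  qed
  then have "contour_integral ?g (\<lambda>v. cnj v / (1 - (cmod v)\<^sup>2)) =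
      integral {0..1} (\<lambda>t. complex_of_real ((x + t * (y - x)) / (1 - (cmod (?g t))\<^sup>2) * (y - x)))"
    unfolding contour_integral_integral vector_derivative_linepath_at by (simp only:)
  \<comment> \<open>The end points are arbitrary here, so the integrand may fail to be integrable;
    its integral is then 0 by convention.\<close>
  moreover have "Im (integral {0..1} (\<lambda>t. complex_of_real (f t))) = 0" for f :: "real \<Rightarrow> real"
  proof (cases "(\<lambda>t. complex_of_real (f t)) integrable_on {0..1}")
    case True
    then show ?thesis using integral_linear[OF True bounded_linear_Im] by (simp add: o_def)
  qed (simp add: not_integrable_integral)
  ultimately show ?thesis by (simp only:)
qed

text \<open>Collects what the polygon needs of an edge, with length and imaginary part expressed by
  the end points alone. For an arc, distinct end points force distinct angles; on a diameter
  \<open>1 - z * cnj w\<close> is a positive real, so its argument is 0.\<close>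

lemma
  assumes geo: "hyp_geodesic g z w" and "z \<noteq> w"
  defines "T \<equiv> cmod (w - z) / cmod (1 - z * cnj w)"
  shows hyp_geodesic_C1: "g C1_differentiable_on UNIV"
    and hyp_geodesic_negligible: "negligible (path_image g)"
    and hyp_geodesic_length: "((\<lambda>t. 2 / (1 - (cmod (g t))\<^sup>2) * norm (vector_derivative g (at t)))
          has_integral ln ((1 + T) / (1 - T))) {0..1}"
    and hyp_geodesic_Im_contour_integral:
      "Im (contour_integral g (\<lambda>u. cnj u / (1 - (cmod u)\<^sup>2))) = Arg (1 - z * cnj w)"
proof -
  have ends: "pathstart g = z" "pathfinish g = w" and disc: "path_image g \<subseteq> ball 0 1"
    using geo by (auto simp: hyp_geodesic_def)
  consider (circle) c r s t where "orthogonal_to_unit_circle c r" "g = part_circlepath c r s t"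
    | (line) u where "norm u = 1" "g = linepath z w" "path_image g \<subseteq> closed_segment (- u) u"
    using geo unfolding hyp_geodesic_def by blast
  then have "g C1_differentiable_on UNIV \<and> negligible (path_image g) \<and>
      ((\<lambda>t. 2 / (1 - (cmod (g t))\<^sup>2) * norm (vector_derivative g (at t))) has_integral ln ((1 + T) / (1 - T))) {0..1} \<and>
      Im (contour_integral g (\<lambda>u. cnj u / (1 - (cmod u)\<^sup>2))) = Arg (1 - z * cnj w)"
  proof cases
    case (circle c r s t)
    have "s \<noteq> t" using ends \<open>z \<noteq> w\<close> circle by auto
    then interpret orthogonal_arc c r s t
      using circle disc by unfold_locales auto
    have z: "z = E 0" and w: "w = E ((t - s) / 2)" using ends endpoints circle(2) by simp_all
    have "path_image g \<subseteq> sphere c r"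
      unfolding circle(2) using r_pos by (simp add: path_image_part_circlepath_subset')
    then have "negligible (path_image g)" using negligible_sphere negligible_subset by blast
    moreover have "T = \<bar>sin ((t - s) / 2)\<bar> / D ((t - s) / 2)"
      by (simp only: T_def z w cross_ratio_endpoints)
    moreover have "- (t - s) / 2 = - ((t - s) / 2)" by (rule minus_divide_left[symmetric])
    ultimately show ?thesis
      using C1 has_integral_length Im_contour_integral Arg_one_minus
      by (simp only: circle(2) z w) 
  next
    case (line u)
    have "\<exists>x. v = of_real x * u" if v: "v \<in> closed_segment (- u) u" for v
    proof -
      obtain k where "v = (1 - k) *\<^sub>R (- u) + k *\<^sub>R u" using v unfolding closed_segment_def by blast
      then have "v = of_real (2 * k - 1) * u" by (simp add: scaleR_conv_of_real algebra_simps)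
      then show ?thesis by blast
    qed
    moreover have "z \<in> path_image g" "w \<in> path_image g"
      using ends pathstart_in_path_image pathfinish_in_path_image by blast+
    ultimately obtain x y where z: "z = of_real x * u" and w: "w = of_real y * u"
      using line(3) by (meson subsetD)
    have "cmod z < 1" "cmod w < 1" using \<open>z \<in> path_image g\<close> \<open>w \<in> path_image g\<close> disc by auto
    then have x: "\<bar>x\<bar> < 1" and y: "\<bar>y\<bar> < 1" using line(1) by (simp_all add: z w norm_mult)
    have "\<bar>x * y\<bar> < 1" using x y by (simp add: abs_mult abs_mult_less[of x 1 y 1, simplified])
    then have pos: "0 < 1 - x * y" by linarith
    have "z * cnj w = of_real (x * y) * (u * cnj u)" by (simp add: z w)
    also have "u * cnj u = 1" using line(1) by (simp add: complex_norm_square[symmetric])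
    finally have zw: "1 - z * cnj w = of_real (1 - x * y)" by simp
    have "w - z = of_real (y - x) * u" by (simp add: z w algebra_simps)
    then have "cmod (w - z) = \<bar>y - x\<bar>" by (simp only: norm_mult norm_of_real mult_1_right line(1))
    then have T: "T = \<bar>y - x\<bar> / (1 - x * y)" using pos unfolding T_def zw by (simp only: norm_of_real abs_of_pos)
    have "g C1_differentiable_on UNIV"
      unfolding line(2) C1_differentiable_on_def
      by (intro exI[of _ "\<lambda>_. w - z"] conjI ballI has_vector_derivative_linepath_within continuous_intros)
    moreover have "negligible (path_image g)"
      unfolding line(2) by (simp add: negligible_convex_interior interior_closed_segment_ge2)
    moreover have "Arg (1 - z * cnj w) = 0"
      unfolding zw using pos by (simp only: Arg_of_real) simp
    ultimately show ?thesis
      using has_integral_length_diameter[OF line(1) x y] Im_contour_integral_diameter[OF line(1), of x y]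
      unfolding T line(2) z w by simp
  qed
  then show "g C1_differentiable_on UNIV" "negligible (path_image g)"
      "((\<lambda>t. 2 / (1 - (cmod (g t))\<^sup>2) * norm (vector_derivative g (at t))) has_integral ln ((1 + T) / (1 - T))) {0..1}"
      "Im (contour_integral g (\<lambda>u. cnj u / (1 - (cmod u)\<^sup>2))) = Arg (1 - z * cnj w)" by auto
qed

section \<open>Polygons\<close>

text \<open>Each half runs through its path at double speed on half the interval. The derivatives
  match except at finitely many parameters, which an integral ignores.\<close>

lemma has_integral_hyp_length_join:
  assumes l1: "((\<lambda>t. 2 / (1 - (cmod (g1 t))\<^sup>2) * norm (vector_derivative g1 (at t))) has_integral l1) {0..1}"
    and l2: "((\<lambda>t. 2 / (1 - (cmod (g2 t))\<^sup>2) * norm (vector_derivative g2 (at t))) has_integral l2) {0..1}"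
    and valid: "valid_path g1" "valid_path g2"
  shows "((\<lambda>t. 2 / (1 - (cmod ((g1 +++ g2) t))\<^sup>2) * norm (vector_derivative (g1 +++ g2) (at t)))
    has_integral (l1 + l2)) {0..1}"
proof -
  obtain s1 s2 where s1: "finite s1" "\<And>x. x \<in> {0..1} - s1 \<Longrightarrow> g1 differentiable at x"
    and s2: "finite s2" "\<And>x. x \<in> {0..1} - s2 \<Longrightarrow> g2 differentiable at x"
    using valid by (auto simp: valid_path_def piecewise_C1_differentiable_on_def C1_differentiable_on_eq)
  \<comment> \<open>Serves both halves: \<open>b = 0\<close> for the first and \<open>b = 1\<close>
    for the second, with \<open>e\<close> the distance of \<open>x\<close> from the joint
    \<open>1/2\<close>.\<close>
  have chain: "vector_derivative (g1 +++ g2) (at x) = 2 *\<^sub>R vector_derivative g (at (2 * x - b))"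
    if "g differentiable at (2 * x - b)" "0 < e" "\<And>y. dist y x < e \<Longrightarrow> g (2 * y - b) = (g1 +++ g2) y" for g x b e
  proof (rule vector_derivative_at, rule has_vector_derivative_transform_within)
    have "((\<lambda>x. 2 * x - b) has_vector_derivative 2) (at x)"
      by (auto intro!: derivative_eq_intros simp flip: has_real_derivative_iff_has_vector_derivative)
    moreover have "(g has_vector_derivative vector_derivative g (at (2 * x - b))) (at (2 * x - b))"
      using that(1) by (simp add: vector_derivative_works)
    ultimately show "((\<lambda>x. g (2 * x - b)) has_vector_derivative 2 *\<^sub>R vector_derivative g (at (2 * x - b))) (at x)"
      by (rule vector_diff_chain_at[simplified o_def])
  qed (use that in auto)
  let ?L = "\<lambda>g t. 2 / (1 - (cmod (g t))\<^sup>2) * norm (vector_derivative g (at t))"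
  have i1: "((\<lambda>x. 2 * ?L g1 (2 * x)) has_integral l1) {0..1/2}"
    using has_integral_affinity01[OF l1, where m = 2 and c = 0, THEN has_integral_cmul[where c = 2]]
    by (simp only: image_affinity_atLeastAtMost_div_diff) (simp add: scaleR_conv_of_real mult_ac)
  have i2: "((\<lambda>x. 2 * ?L g2 (2 * x - 1)) has_integral l2) {1/2..1}"
    using has_integral_affinity01[OF l2, where m = 2 and c = "-1", THEN has_integral_cmul[where c = 2]]
    by (simp only: image_affinity_atLeastAtMost_div_diff) (simp add: scaleR_conv_of_real mult_ac)
  have "(?L (g1 +++ g2) has_integral l1) {0..1/2}"
  proof (rule has_integral_spike_finite[OF _ _ i1])
    show "finite (insert (1/2) ((*) 2 -` s1))"
      using s1 by (force intro: finite_vimageI[where h = "(*) 2"] inj_onI)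
    fix x :: real assume x: "x \<in> {0..1/2} - insert (1/2) ((*) 2 -` s1)"
    then have "g1 differentiable at (2 * x - 0)" using s1(2)[of "2 * x"] by auto
    from chain[OF this, of "\<bar>x - 1/2\<bar>"] x
    have "vector_derivative (g1 +++ g2) (at x) = 2 *\<^sub>R vector_derivative g1 (at (2 * x))"
      by (auto simp: joinpaths_def dist_real_def abs_if split: if_split_asm)
    then show "?L (g1 +++ g2) x = 2 * ?L g1 (2 * x)" using x by (simp add: joinpaths_def)
  qed
  moreover have "(?L (g1 +++ g2) has_integral l2) {1/2..1}"
  proof (rule has_integral_spike_finite[OF _ _ i2])
    show "finite (insert (1/2) ((\<lambda>x. 2 * x - 1) -` s2))"
      using s2 by (force intro: finite_vimageI[where h = "\<lambda>x. 2 * x - 1"] inj_onI)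
    fix x :: real assume x: "x \<in> {1/2..1} - insert (1/2) ((\<lambda>x. 2 * x - 1) -` s2)"
    then have "g2 differentiable at (2 * x - 1)" using s2(2)[of "2 * x - 1"] by auto
    from chain[OF this, of "\<bar>x - 1/2\<bar>"] x
    have "vector_derivative (g1 +++ g2) (at x) = 2 *\<^sub>R vector_derivative g2 (at (2 * x - 1))"
      by (auto simp: joinpaths_def dist_real_def abs_if split: if_split_asm)
    then show "?L (g1 +++ g2) x = 2 * ?L g2 (2 * x - 1)" using x by (simp add: joinpaths_def)
  qed
  ultimately show ?thesis
    by (rule has_integral_combine[where c = "1/2", rotated 2]) auto
qed

text \<open>All four facts come from one induction on the number of edges: the new edge is appended
  last, and joining the integrals or images uses validity and end points of the path built so
  far.\<close>

lemma
  fixes g :: "nat \<Rightarrow> real \<Rightarrow> complex"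
  assumes "1 \<le> n"
    and "\<And>k. k \<in> {1..n} \<Longrightarrow> valid_path (g k) \<and> pathstart (g k) = z k \<and> pathfinish (g k) = z (k + 1)"
  defines "\<gamma> \<equiv> foldl (+++) (g 1) (map g [2..<n + 1])"
  shows valid_path_foldl_join: "valid_path \<gamma> \<and> pathstart \<gamma> = z 1 \<and> pathfinish \<gamma> = z (n + 1)"
    and path_image_foldl_join: "path_image \<gamma> = (\<Union>k\<in>{1..n}. path_image (g k))"
    and has_contour_integral_foldl_join:
      "(\<And>k. k \<in> {1..n} \<Longrightarrow> f contour_integrable_on g k) \<Longrightarrow>
        (f has_contour_integral (\<Sum>k=1..n. contour_integral (g k) f)) \<gamma>"
    and has_integral_hyp_length_foldl_join:
      "(\<And>k. k \<in> {1..n} \<Longrightarrow> ((\<lambda>t. 2 / (1 - (cmod (g k t))\<^sup>2) * norm (vector_derivative (g k) (at t))) has_integral l k) {0..1}) \<Longrightarrow>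
        ((\<lambda>t. 2 / (1 - (cmod (\<gamma> t))\<^sup>2) * norm (vector_derivative \<gamma> (at t))) has_integral (\<Sum>k=1..n. l k)) {0..1}"
proof -
  let ?P = "\<lambda>n \<gamma>. valid_path \<gamma> \<and> pathstart \<gamma> = z 1 \<and> pathfinish \<gamma> = z (n + 1) \<and>
      path_image \<gamma> = (\<Union>k\<in>{1..n}. path_image (g k)) \<and>
      ((\<forall>k\<in>{1..n}. f contour_integrable_on g k) \<longrightarrow>
        (f has_contour_integral (\<Sum>k=1..n. contour_integral (g k) f)) \<gamma>) \<and>
      ((\<forall>k\<in>{1..n}. ((\<lambda>t. 2 / (1 - (cmod (g k t))\<^sup>2) * norm (vector_derivative (g k) (at t))) has_integral l k) {0..1}) \<longrightarrow>
        ((\<lambda>t. 2 / (1 - (cmod (\<gamma> t))\<^sup>2) * norm (vector_derivative \<gamma> (at t))) has_integral (\<Sum>k=1..n. l k)) {0..1})"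
  have "?P n (foldl (+++) (g 1) (map g [2..<n + 1]))"
    using assms(1,2)
  proof (induction n rule: nat_induct_at_least)
    case base
    then show ?case by (auto simp: has_contour_integral_integral)
  next
    case (Suc n)
    define \<delta> where "\<delta> = foldl (+++) (g 1) (map g [2..<n + 1])"
    have IH: "?P n \<delta>" unfolding \<delta>_def using Suc by auto
    have new: "valid_path (g (n + 1))" "pathstart (g (n + 1)) = z (n + 1)" "pathfinish (g (n + 1)) = z (n + 2)"
      using Suc.prems[of "n + 1"] by auto
    have eq: "foldl (+++) (g 1) (map g [2..<Suc n + 1]) = \<delta> +++ g (n + 1)"
      using Suc.hyps by (simp add: \<delta>_def)
    have Icc: "{1..Suc n} = insert (n + 1) {1..n}" by auto
    show ?case
      unfolding eq
    proof (intro conjI impI)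
      show "valid_path (\<delta> +++ g (n + 1))" using IH new by (intro valid_path_join) auto
      show "path_image (\<delta> +++ g (n + 1)) = (\<Union>k\<in>{1..Suc n}. path_image (g k))"
        using IH new unfolding Icc by (subst path_image_join) (simp_all add: Un_commute)
      show "(f has_contour_integral (\<Sum>k=1..Suc n. contour_integral (g k) f)) (\<delta> +++ g (n + 1))"
        if "\<forall>k\<in>{1..Suc n}. f contour_integrable_on g k"
        using has_contour_integral_join[of f _ \<delta> _ "g (n + 1)"] IH new that
        by (simp add: has_contour_integral_integral)
      show "((\<lambda>t. 2 / (1 - (cmod ((\<delta> +++ g (n + 1)) t))\<^sup>2) * norm (vector_derivative (\<delta> +++ g (n + 1)) (at t)))
          has_integral (\<Sum>k=1..Suc n. l k)) {0..1}"
        if "\<forall>k\<in>{1..Suc n}. ((\<lambda>t. 2 / (1 - (cmod (g k t))\<^sup>2) * norm (vector_derivative (g k) (at t))) has_integral l k) {0..1}"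
        using has_integral_hyp_length_join[of \<delta> _ "g (n + 1)" "l (n + 1)"] IH new that by simp
    qed (use IH new in auto)
  qed
  then show "valid_path \<gamma> \<and> pathstart \<gamma> = z 1 \<and> pathfinish \<gamma> = z (n + 1)"
    "path_image \<gamma> = (\<Union>k\<in>{1..n}. path_image (g k))"
    "(\<And>k. k \<in> {1..n} \<Longrightarrow> f contour_integrable_on g k) \<Longrightarrow>
        (f has_contour_integral (\<Sum>k=1..n. contour_integral (g k) f)) \<gamma>"
    "(\<And>k. k \<in> {1..n} \<Longrightarrow> ((\<lambda>t. 2 / (1 - (cmod (g k t))\<^sup>2) * norm (vector_derivative (g k) (at t))) has_integral l k) {0..1}) \<Longrightarrow>
        ((\<lambda>t. 2 / (1 - (cmod (\<gamma> t))\<^sup>2) * norm (vector_derivative \<gamma> (at t))) has_integral (\<Sum>k=1..n. l k)) {0..1}"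
    unfolding \<gamma>_def by blast+
qed

text \<open>The first two summands telescope in a sum over a closed polygon, and
  \<open>ln ((1 + T) / (1 - T))\<close> is the hyperbolic distance.\<close>

lemma Ln_vertex_term:
  fixes z w a :: complex
  assumes z: "cmod z < 1" and w: "cmod w < 1" and "z \<noteq> w"
    and a: "a = (1 - cnj z * w) / (w - z)"
  defines "T \<equiv> cmod (w - z) / cmod (1 - z * cnj w)"
  shows "Ln (((cmod a)\<^sup>2 + cnj (a * z)) / ((cmod a)\<^sup>2 + cmod a)) =
    of_real ((ln (1 - (cmod z)\<^sup>2) - ln (1 - (cmod w)\<^sup>2) - ln ((1 + T) / (1 - T))) / 2) + \<i> * Arg (1 - z * cnj w)"
proof -
  define N where "N = cmod (1 - z * cnj w)"
  define d where "d = cmod (w - z)"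
  have d: "0 < d" using \<open>z \<noteq> w\<close> by (simp add: d_def)
  have z2: "0 < 1 - (cmod z)\<^sup>2" and w2: "0 < 1 - (cmod w)\<^sup>2" using z w by (simp_all add: abs_square_less_1)
  \<comment> \<open>The same identity as behind \<open>D_sin_squared\<close>; here it yields
    \<open>d < N\<close> and, at the end, the logarithm of \<open>(N + d) * (N - d)\<close>.\<close>
  have Nd: "N\<^sup>2 - d\<^sup>2 = (1 - (cmod z)\<^sup>2) * (1 - (cmod w)\<^sup>2)"
    unfolding N_def d_def cmod_power2 by (simp add: power2_eq_square algebra_simps)
  then have "0 < N\<^sup>2 - d\<^sup>2" using z2 w2 by simp
  then have "d < N" using power2_less_imp_less[of d N] by (simp add: N_def)
  then have N: "0 < N" using d by linarith
  then have v0: "1 - z * cnj w \<noteq> 0" by (auto simp: N_def)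
  have "cmod (1 - cnj z * w) = N"
    unfolding N_def by (subst complex_mod_cnj[symmetric]) simp
  then have norm_a: "cmod a = N / d" by (simp add: a d_def norm_divide)
  \<comment> \<open>The numerator is \<open>(1 - z * cnj w) * (1 - |z|^2) / d^2\<close> and the
    denominator \<open>N * (N + d) / d^2\<close>, so \<open>k\<close> is the positive factor in
    front of \<open>1 - z * cnj w\<close>.\<close>
  define k where "k = (1 - (cmod z)\<^sup>2) / (N * (N + d))"
  have k: "0 < k" using z2 N d by (simp add: k_def)
  have dd: "of_real d * of_real d = (w - z) * cnj (w - z)"
    by (simp only: d_def power2_eq_square[symmetric] of_real_power[symmetric] complex_norm_square)
  have wz: "w - z \<noteq> 0" using \<open>z \<noteq> w\<close> by simp
  have "((cmod a)\<^sup>2 + cnj (a * z)) = cnj a * (a + cnj z)"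
    by (simp add: complex_norm_square distrib_left mult.commute flip: of_real_power)
  also have "a + cnj z = (1 - (cmod z)\<^sup>2) / (w - z)"
    using wz by (simp add: a field_simps complex_norm_square flip: of_real_power)
  also have "cnj a = (1 - z * cnj w) / cnj (w - z)" by (simp add: a)
  also have "(1 - z * cnj w) / cnj (w - z) * ((1 - (cmod z)\<^sup>2) / (w - z)) =
      (1 - z * cnj w) * (1 - (cmod z)\<^sup>2) / (of_real d * of_real d)"
    unfolding dd by (simp add: mult.commute)
  finally have num: "(cmod a)\<^sup>2 + cnj (a * z) = (1 - z * cnj w) * (1 - (cmod z)\<^sup>2) / (of_real d * of_real d)" .
  have "(cmod a)\<^sup>2 + cmod a = N * (N + d) / (d * d)"
    using d unfolding norm_a by (simp add: field_simps power2_eq_square)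
  then have "((cmod a)\<^sup>2 + cnj (a * z)) / complex_of_real ((cmod a)\<^sup>2 + cmod a) = of_real k * (1 - z * cnj w)"
    unfolding num using d N by (simp add: k_def)
  then have "Ln (((cmod a)\<^sup>2 + cnj (a * z)) / ((cmod a)\<^sup>2 + cmod a)) = ln k + Ln (1 - z * cnj w)"
    using k v0 by (simp add: Ln_times_of_real Ln_of_real)
  also have "Ln (1 - z * cnj w) = of_real (ln N) + \<i> * Arg (1 - z * cnj w)"
    by (rule complex_eqI) (use v0 in \<open>simp_all add: Arg_eq_Im_Ln N_def\<close>)
  also have "ln k = ln (1 - (cmod z)\<^sup>2) - ln N - ln (N + d)"
    using z2 N d by (simp add: k_def ln_div ln_mult)
  also have "complex_of_real (ln (1 - (cmod z)\<^sup>2) - ln N - ln (N + d)) + (of_real (ln N) + \<i> * Arg (1 - z * cnj w)) =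
      of_real (ln (1 - (cmod z)\<^sup>2) - ln (N + d)) + \<i> * Arg (1 - z * cnj w)"
    by simp
  \<comment> \<open>\<open>ln (N + d)\<close> is half the sum of the logarithms of
    \<open>(N + d) * (N - d)\<close> and \<open>(N + d) / (N - d)\<close>; the former is a product
    of end point terms, the latter gives the distance.\<close>
  also have "ln (1 - (cmod z)\<^sup>2) - ln (N + d) =
      (ln (1 - (cmod z)\<^sup>2) - ln (1 - (cmod w)\<^sup>2) - ln ((1 + T) / (1 - T))) / 2"
  proof -
    have "(1 + T) / (1 - T) = (N + d) / (N - d)"
      unfolding T_def N_def[symmetric] d_def[symmetric] using N \<open>d < N\<close> by (simp add: field_simps)
    then have "ln ((1 + T) / (1 - T)) = ln (N + d) - ln (N - d)"
      using \<open>d < N\<close> d by (simp add: ln_div)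
    moreover have "ln (N + d) + ln (N - d) = ln (1 - (cmod z)\<^sup>2) + ln (1 - (cmod w)\<^sup>2)"
    proof -
      have "(N + d) * (N - d) = (1 - (cmod z)\<^sup>2) * (1 - (cmod w)\<^sup>2)"
        using Nd by (simp add: power2_eq_square algebra_simps)
      moreover have "ln ((N + d) * (N - d)) = ln (N + d) + ln (N - d)"
        using \<open>d < N\<close> d by (simp add: ln_mult)
      moreover have "ln ((1 - (cmod z)\<^sup>2) * (1 - (cmod w)\<^sup>2)) = ln (1 - (cmod z)\<^sup>2) + ln (1 - (cmod w)\<^sup>2)"
        using z2 w2 by (simp add: ln_mult)
      ultimately show ?thesis by simp
    qed
    ultimately show ?thesis by simp
  qed
  finally show ?thesis .
qed

theorem mainTheorem4:
  fixes n :: nat and z a :: "nat \<Rightarrow> complex" and \<gamma> :: "real \<Rightarrow> complex" and A P :: real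
  assumes "n \<ge> 3"
    and "\<And>k. k \<in> {1..n} \<Longrightarrow> z k \<in> ball 0 1"
    and "z (n + 1) = z 1"
    and "\<And>k. k \<in> {1..n} \<Longrightarrow> z k \<noteq> z (k + 1)"
    and "hyp_polygon_boundary n z \<gamma>"
    and "positively_oriented \<gamma>"
    and "\<And>k. k \<in> {1..n} \<Longrightarrow> a k = (1 - cnj (z k) * z (k + 1)) / (z (k + 1) - z k)"
    and "A = hyp_area (inside (path_image \<gamma>))"
    and "P = hyp_length \<gamma>"
  shows "complex_of_real A + \<i> * complex_of_real P =
    2 / \<i> * (\<Sum>k=1..n. Ln (((cmod (a k))\<^sup>2 + cnj (a k * z k)) /
                            ((cmod (a k))\<^sup>2 + cmod (a k))))"
proof -
  obtain g where geo: "\<And>k. k \<in> {1..n} \<Longrightarrow> hyp_geodesic (g k) (z k) (z (k + 1))"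
    and \<gamma>: "\<gamma> = foldl (+++) (g 1) (map g [2..<n + 1])"
    and simple: "simple_path \<gamma>" "pathfinish \<gamma> = pathstart \<gamma>"
    using assms(5) unfolding hyp_polygon_boundary_def by blast
  have C1: "g k C1_differentiable_on UNIV" if "k \<in> {1..n}" for k
    using hyp_geodesic_C1[OF geo[OF that] assms(4)[OF that]] .
  have valid: "valid_path (g k)" if "k \<in> {1..n}" for k
    using C1[OF that] C1_differentiable_imp_piecewise C1_differentiable_on_subset
    unfolding valid_path_def by blast
  have ends: "valid_path (g k) \<and> pathstart (g k) = z k \<and> pathfinish (g k) = z (k + 1)" if "k \<in> {1..n}" for k
    using geo[OF that] valid[OF that] by (simp add: hyp_geodesic_def)
  have "1 \<le> n" using assms(1) by simp
  have valid_\<gamma>: "valid_path \<gamma>"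
    using valid_path_foldl_join[where g = g and z = z, OF \<open>1 \<le> n\<close> ends] by (simp add: \<gamma>)
  have image_\<gamma>: "path_image \<gamma> = (\<Union>k\<in>{1..n}. path_image (g k))"
    unfolding \<gamma> by (rule path_image_foldl_join[where g = g and z = z, OF \<open>1 \<le> n\<close> ends])
  define T where "T k = cmod (z (k + 1) - z k) / cmod (1 - z k * cnj (z (k + 1)))" for k
  define J where "J k = contour_integral (g k) (\<lambda>u. cnj u / (1 - (cmod u)\<^sup>2))" for k

  have "complex_of_real A = 2 / \<i> * (\<Sum>k=1..n. J k)"
    unfolding assms(8) J_def
  proof (rule hyp_area_inside_eq_contour_integrals)
    show "path \<gamma>" "pathfinish \<gamma> = pathstart \<gamma>" "positively_oriented \<gamma>"
      using simple assms(6) by (auto simp: simple_path_imp_path)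
    show "path_image \<gamma> \<subseteq> ball 0 1" using geo unfolding image_\<gamma> hyp_geodesic_def by blast
    show "negligible (path_image \<gamma>)"
      unfolding image_\<gamma> using hyp_geodesic_negligible[OF geo assms(4)] by (intro negligible_Union) auto
    show "g k C1_differentiable_on UNIV" "path_image (g k) \<subseteq> path_image \<gamma>" if "k \<in> {1..n}" for k
      using C1 that unfolding image_\<gamma> by blast+
    show "winding_number \<gamma> w = 1 / (2 * pi * \<i>) * (\<Sum>k\<in>{1..n}. contour_integral (g k) (\<lambda>u. 1 / (u - w)))"
      if w: "w \<notin> path_image \<gamma>" for w
    proof -
      have "(\<lambda>u. 1 / (u - w)) contour_integrable_on g k" if "k \<in> {1..n}" for k
        using w that valid[OF that] unfolding image_\<gamma> by (intro contour_integrable_inversediff) auto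
      from contour_integral_unique[OF has_contour_integral_foldl_join[where g = g and z = z, OF \<open>1 \<le> n\<close> ends this, folded \<gamma>]] show ?thesis
        using w valid_\<gamma> by (simp add: winding_number_valid_path)
    qed
  qed
  \<comment> \<open>Since \<open>A\<close> is real, taking real parts loses nothing, and division by
    \<open>\<i>\<close> leaves only the imaginary parts of the edge integrals.\<close>
  then have "A = Re (2 / \<i> * (\<Sum>k=1..n. J k))" by (metis Re_complex_of_real)
  also have "\<dots> = 2 * Im (\<Sum>k=1..n. J k)" by (simp add: Re_divide)
  also have "\<dots> = 2 * (\<Sum>k=1..n. Arg (1 - z k * cnj (z (k + 1))))"
    unfolding Im_sum J_def
    by (intro arg_cong[where f = "(*) 2"] sum.cong refl hyp_geodesic_Im_contour_integral[OF geo assms(4)])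
  finally have A: "A = 2 * (\<Sum>k=1..n. Arg (1 - z k * cnj (z (k + 1))))" .

  have P: "P = (\<Sum>k=1..n. ln ((1 + T k) / (1 - T k)))"
    unfolding assms(9) hyp_length_def T_def \<gamma>
    by (intro integral_unique has_integral_hyp_length_foldl_join[where g = g and z = z, OF \<open>1 \<le> n\<close> ends] hyp_geodesic_length geo assms(4))

  have disc: "cmod (z k) < 1" if "k \<in> {1..n + 1}" for k
    using that assms(2)[of k] assms(2)[of 1] assms(1,3) by (cases "k = n + 1") auto
  have tele: "(\<Sum>k=1..m. f k - f (k + 1)) = f 1 - f (m + 1)" for f :: "nat \<Rightarrow> real" and m
    by (induction m) auto
  have "(\<Sum>k=1..n. Ln (((cmod (a k))\<^sup>2 + cnj (a k * z k)) / ((cmod (a k))\<^sup>2 + cmod (a k)))) =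
      (\<Sum>k=1..n. of_real ((ln (1 - (cmod (z k))\<^sup>2) - ln (1 - (cmod (z (k + 1)))\<^sup>2) - ln ((1 + T k) / (1 - T k))) / 2) +
        \<i> * Arg (1 - z k * cnj (z (k + 1))))"
    unfolding T_def by (intro sum.cong refl Ln_vertex_term disc assms(4,7)) auto
  also have "\<dots> = of_real (((\<Sum>k=1..n. ln (1 - (cmod (z k))\<^sup>2) - ln (1 - (cmod (z (k + 1)))\<^sup>2)) - P) / 2) + \<i> * of_real (A / 2)"
    unfolding P A by (simp add: sum.distrib sum_subtractf sum_distrib_left diff_divide_distrib sum_divide_distrib)
  \<comment> \<open>The telescoped difference vanishes because
    \<open>z (n + 1) = z 1\<close>.\<close>
  also have "(\<Sum>k=1..n. ln (1 - (cmod (z k))\<^sup>2) - ln (1 - (cmod (z (k + 1)))\<^sup>2)) = 0"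
    by (subst tele, subst assms(3)) simp
  \<comment> \<open>The sum equals \<open>- P / 2 + \<i> * A / 2\<close>, and
    \<open>2 / \<i>\<close> times this is \<open>A + \<i> * P\<close>.\<close>
  finally show ?thesis by (simp add: complex_eq_iff Re_divide Im_divide)
qed

end
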